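(* Let $K$ be an uncountable, non-exploding compact metric space and let $d\in\mathbb{N}^+$. Then for the prevalent $f\in C(K,\mathbb{R}^d)$ we have $$\dim_P\operatorname{graph}(f)=\dim_P K+d.$$
   Context: Prevalence: for an abelian Polish group $G$, a set $A\subset G$ is shy if there exist a Borel set $B\supset A$ in $G$ and a Borel probability measure $\nu$ on $G$ with $\nu(B+x)=0$ for all $x\in G$; complements of shy sets are prevalent. "For the prevalent $f\in G$ property $P$ holds" means that $\{f\in G: P(f)\}$ is prevalent. For compact metric $K$, $C(K,\mathbb{R}^d)$ is the Banach space of continuous maps $K\to\mathbb{R}^d$ with the maximum norm (an abelian Polish group under addition). Packing dimension: for a non-empty totally bounded metric space $X$, $N_\delta(X)$ is the smallest number of closed balls of radius $\delta$ covering $X$, and $\overline{\dim}_B X=\limsup_{\delta\to0+}\log N_\delta(X)/\log(1/\delta)$; $\overline{\dim}_B\emptyset=-1$ and $\overline{\dim}_B X=\infty$ if $X$ is not totally bounded. $\dim_P X=\inf\{\sup_i\overline{\dim}_B X_i: X=\bigcup_{i=1}^\infty X_i\}$. Non-exploding: for a metric space $X$ and $r>0$ let $N(r)$ be the minimal number such that every closed ball $B(x,r)$ can be covered by $N(r)$ closed balls of radius $r/2$. $X$ is non-exploding if $\lim_{r\to0+}\frac{\log N(r)}{\log r}=0$. $\operatorname{graph}(f)=\{(x,f(x)): x\in K\}\subset K\times\mathbb{R}^d$, where products of metric spaces carry the $\ell^2$-product metric $d((x_1,y_1),(x_2,y_2))=\sqrt{d_X(x_1,x_2)^2+d_Y(y_1,y_2)^2}$.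 *)

theory Defs
  imports "HOL-Probability.Probability"
begin

text \<open>Shyness is meant for groups whose topology is Polish. The class constraint does not demand
  this, since the space \<open>'a \<Rightarrow>\<^sub>C 'b\<close> is separable only under a compactness assumption on the
  type \<open>'a\<close>, which is not expressible by an existing type class.\<close>

definition shy :: "'g::topological_ab_group_add set \<Rightarrow> bool" where
  "shy A \<longleftrightarrow> (\<exists>B \<nu>. A \<subseteq> B \<and> B \<in> sets borel \<and> prob_space \<nu> \<and> sets \<nu> = sets borel \<and>
     (\<forall>x. emeasure \<nu> ((\<lambda>b. b + x) ` B) = 0))"

definition prevalent :: "'g::topological_ab_group_add set \<Rightarrow> bool" where
  "prevalent A \<longleftrightarrow> shy (- A)"

text \<open>A subset \<open>X\<close> of the ambient type is regarded as a metric space in its own right, so its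
  closed balls have their centres in \<open>X\<close>. Covering by \<open>n\<close> balls means that at most \<open>n\<close> centres
  suffice; the numbers below are the least such \<open>n\<close>, and are only used where one exists.\<close>

definition covered_by_balls :: "'a::metric_space set \<Rightarrow> 'a set \<Rightarrow> real \<Rightarrow> nat \<Rightarrow> bool" where
  "covered_by_balls X Y r n \<longleftrightarrow>
     (\<exists>C. C \<subseteq> X \<and> finite C \<and> card C \<le> n \<and> Y \<subseteq> (\<Union>c\<in>C. cball c r))"

definition covering_number :: "'a::metric_space set \<Rightarrow> real \<Rightarrow> nat" where
  "covering_number X \<delta> = (LEAST n. covered_by_balls X X \<delta> n)"

definition upper_box_dim :: "'a::metric_space set \<Rightarrow> ereal" where
  "upper_box_dim X =
     (if X = {} then -1
      else if totally_bounded X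
        then Limsup (at_right 0) (\<lambda>\<delta>. ereal (ln (real (covering_number X \<delta>)) / ln (1 / \<delta>)))
      else \<infinity>)"

definition packing_dim :: "'a::metric_space set \<Rightarrow> ereal" where
  "packing_dim X = Inf {(SUP i. upper_box_dim (Y i)) | Y :: nat \<Rightarrow> 'a set. X = (\<Union>i. Y i)}"

definition halving_number :: "'a::metric_space set \<Rightarrow> real \<Rightarrow> nat" where
  "halving_number X r = (LEAST n. \<forall>x\<in>X. covered_by_balls X (X \<inter> cball x r) (r / 2) n)"

text \<open>The first conjunct says that the number \<open>N(r)\<close> is finite for small \<open>r\<close>; it holds
  automatically when \<open>X\<close> is compact.\<close>

definition non_exploding :: "'a::metric_space set \<Rightarrow> bool" where
  "non_exploding X \<longleftrightarrow>
     (\<forall>\<^sub>F r in at_right 0. \<exists>n. \<forall>x\<in>X. covered_by_balls X (X \<inter> cball x r) (r / 2) n) \<and>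
     ((\<lambda>r. ln (real (halving_number X r)) / ln r) \<longlongrightarrow> 0) (at_right 0)"

text \<open>The metric of the library on the product type is the \<open>\<ell>\<^sup>2\<close>-product metric.\<close>

definition fun_graph :: "('a \<Rightarrow> 'b) \<Rightarrow> ('a \<times> 'b) set" where
  "fun_graph f = {(x, f x) | x. True}"

end

theory Submission
  imports Defs
begin

text \<open>The upper bound holds for every \<open>f\<close>, as the graph over a piece \<open>Y\<close> lies in \<open>Y\<close> times a cube.

  For the lower bound let \<open>t < dim\<^sub>P K\<close> and remove from \<open>K\<close> all open sets that are countable
  unions of finite sets and of sets of upper box dimension at most \<open>t\<close>. Every non-empty portion of
  the remaining closed set \<open>F\<close> is infinite and has upper box dimension above \<open>t\<close>. By Baire's
  theorem, \<open>dim\<^sub>P graph f \<ge> t + d\<close> as soon as the graph over each such portion has upper box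
  dimension at least \<open>t + d\<close>, so only countably many sets \<open>A\<close> have to be treated.

  The measure is the law of \<open>f = \<Sum>n. f\<^sub>n\<close>, where \<open>f\<^sub>n\<close> has amplitude \<open>2\<^sup>-\<^sup>n\<close> and serves one of the sets
  \<open>A\<close>, at a scale \<open>\<delta>\<close> so small that \<open>2\<^sup>-\<^sup>n\<close> is a negligible power of \<open>\<delta>\<close>. Close to each point of a
  maximal separated subset of \<open>A\<close> one picks about \<open>\<delta> powr - d\<close> points of \<open>A\<close>, which may be
  arbitrarily close to each other, and gives them independent uniform values in a grid of mesh
  comparable to \<open>\<delta>\<close>. Conditionally on all other values, a translate \<open>f + g\<close> brings
  two of these points together with probability at most the inverse of the grid size, so by Markov's
  inequality half of the points have separated images in the graph with probability
  close to \<open>1\<close>.\<close>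

section \<open>Covering numbers and upper box dimension\<close>

text \<open>Centres have to lie in \<open>X\<close>. Replacing each useful centre by a point of
  \<open>X\<close> in its ball costs a factor 2 in the radius and does not increase the number of
  balls.\<close>

lemma covered_by_balls_recentre:
  assumes "X \<subseteq> (\<Union>c\<in>C. cball c \<delta>)" "finite C" "card C \<le> n"
  shows "covered_by_balls X X (2 * \<delta>) n"
proof -
  let ?D = "{c \<in> C. X \<inter> cball c \<delta> \<noteq> {}}"
  define g where "g c = (SOME x. x \<in> X \<inter> cball c \<delta>)" for c
  have g: "g c \<in> X \<inter> cball c \<delta>" if "c \<in> ?D" for c
    unfolding g_def some_in_eq using that by simp
  have "X \<subseteq> (\<Union>c\<in>g ` ?D. cball c (2 * \<delta>))"
  proof
    fix x assume x: "x \<in> X"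
    then obtain c where c: "c \<in> C" "dist c x \<le> \<delta>" using assms(1) by auto
    then have "c \<in> ?D" using x by auto
    moreover from g[OF this] have "dist c (g c) \<le> \<delta>" by auto
    then have "dist (g c) x \<le> 2 * \<delta>"
      using c(2) dist_triangle[of "g c" x c] by (simp add: dist_commute)
    ultimately show "x \<in> (\<Union>c\<in>g ` ?D. cball c (2 * \<delta>))" by auto
  qed
  moreover have "card (g ` ?D) \<le> n"
    using card_image_le[of ?D g] card_mono[of C ?D] assms(2,3) by auto
  ultimately show ?thesis
    unfolding covered_by_balls_def using g assms(2) by (intro exI[of _ "g ` ?D"]) auto
qed

lemma totally_bounded_cball_cover:
  assumes "totally_bounded X" "\<delta> > 0"
  obtains C where "finite C" "X \<subseteq> (\<Union>c\<in>C. cball c \<delta>)"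
proof -
  obtain C where C: "finite C" "X \<subseteq> (\<Union>x\<in>C. {y. dist x y < \<delta>})"
    using assms unfolding totally_bounded_metric by blast
  note C(2)
  also have "(\<Union>x\<in>C. {y. dist x y < \<delta>}) \<subseteq> (\<Union>c\<in>C. cball c \<delta>)"
    by (intro UN_mono) auto
  finally have "X \<subseteq> (\<Union>c\<in>C. cball c \<delta>)" .
  then show thesis using that C(1) by blast
qed

lemma covering_number_le: "covered_by_balls X X \<delta> n \<Longrightarrow> covering_number X \<delta> \<le> n"
  unfolding covering_number_def by (rule Least_le)

text \<open>Total boundedness provides centres anywhere in the space; halving the radius beforehand
  compensates for moving them into \<open>X\<close>. Hence the \<open>LEAST\<close> in the
  definition is attained.\<close>

lemma covering_number_covers:
  assumes "totally_bounded X" "\<delta> > 0"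
  shows "covered_by_balls X X \<delta> (covering_number X \<delta>)"
proof -
  obtain C where C: "finite C" "X \<subseteq> (\<Union>c\<in>C. cball c (\<delta> / 2))"
    using totally_bounded_cball_cover[OF assms(1), of "\<delta> / 2"] assms(2) by auto
  then have "covered_by_balls X X \<delta> (card C)"
    using covered_by_balls_recentre[OF C(2,1) order_refl] by simp
  then show ?thesis unfolding covering_number_def by (rule LeastI)
qed

lemma covering_number_ge_1:
  assumes "totally_bounded X" "\<delta> > 0" "X \<noteq> {}"
  shows "1 \<le> covering_number X \<delta>"
proof -
  obtain C where C: "finite C" "card C \<le> covering_number X \<delta>" "X \<subseteq> (\<Union>c\<in>C. cball c \<delta>)"
    using covering_number_covers[OF assms(1,2)] unfolding covered_by_balls_def by blast
  then have "C \<noteq> {}" using assms(3) by auto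
  then have "card C > 0" using C(1) by (simp add: card_gt_0_iff)
  then show ?thesis using C(2) by simp
qed

text \<open>Two points of one ball of radius \<open>\<delta>\<close> have distance at most
  \<open>2 * \<delta>\<close>, so sending each point of \<open>S\<close> to a ball containing it is
  injective.\<close>

lemma card_separated_le_covering_number:
  assumes "totally_bounded X" "\<delta> > 0" "S \<subseteq> X" "pairwise (\<lambda>x y. dist x y > 2 * \<delta>) S"
  shows "finite S" "card S \<le> covering_number X \<delta>"
proof -
  obtain C where C: "finite C" "card C \<le> covering_number X \<delta>" "X \<subseteq> (\<Union>c\<in>C. cball c \<delta>)"
    using covering_number_covers[OF assms(1,2)] unfolding covered_by_balls_def by blast
  have "\<forall>s\<in>S. \<exists>c\<in>C. dist c s \<le> \<delta>" 
  proof
    fix s assume "s \<in> S"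
    then have "s \<in> (\<Union>c\<in>C. cball c \<delta>)" using C(3) assms(3) by (meson subsetD)
    then show "\<exists>c\<in>C. dist c s \<le> \<delta>" by simp
  qed
  then obtain g where g: "\<And>s. s \<in> S \<Longrightarrow> g s \<in> C \<and> dist (g s) s \<le> \<delta>" by metis
  have inj: "inj_on g S"
  proof (rule inj_onI, rule ccontr)
    fix x y assume xy: "x \<in> S" "y \<in> S" "g x = g y" "x \<noteq> y"
    then have "dist x y > 2 * \<delta>" using assms(4) by (auto simp: pairwise_def)
    moreover have "dist x y \<le> dist (g x) x + dist (g x) y" by (rule dist_triangle3)
    ultimately show False using g[OF xy(1)] g[OF xy(2)] xy(3) by simp
  qed
  have sub: "g ` S \<subseteq> C" using g by auto
  show "finite S" using inj sub C(1) by (rule inj_on_finite)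
  show "card S \<le> covering_number X \<delta>"
    using card_inj_on_le[OF inj sub C(1)] C(2) by simp
qed

text \<open>A separated set of maximal cardinality is also a net: a point outside its
  \<open>\<delta>\<close>-balls could be added. The maximum exists because the covering number at
  \<open>\<delta> / 2\<close> bounds all these cardinalities.\<close>

lemma separated_set_ge_covering_number:
  assumes "totally_bounded X" "\<delta> > 0"
  obtains S where "finite S" "S \<subseteq> X" "pairwise (\<lambda>x y. dist x y > \<delta>) S"
    "covering_number X \<delta> \<le> card S"
proof -
  define P where "P S \<longleftrightarrow> S \<subseteq> X \<and> pairwise (\<lambda>x y. dist x y > \<delta>) S" for S
  have fin: "finite S \<and> card S \<le> covering_number X (\<delta> / 2)" if "P S" for S
    using card_separated_le_covering_number[OF assms(1), of "\<delta> / 2" S] that assms(2)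
    by (simp add: P_def)
  have "P {}" by (simp add: P_def)
  moreover have "\<forall>S. P S \<longrightarrow> card S < Suc (covering_number X (\<delta> / 2))"
    using fin by (auto simp: less_Suc_eq_le)
  ultimately obtain S where S: "P S" "\<And>T. P T \<Longrightarrow> card T \<le> card S"
    using ex_has_greatest_nat[of P "{}" card] by blast
  have "x \<in> (\<Union>c\<in>S. cball c \<delta>)" if x: "x \<in> X" for x
  proof (rule ccontr)
    assume nx: "x \<notin> (\<Union>c\<in>S. cball c \<delta>)"
    then have far: "\<And>s. s \<in> S \<Longrightarrow> dist s x > \<delta> \<and> dist x s > \<delta>"
      by (auto simp: not_le dist_commute)
    then have "P (insert x S)"
      using S(1) x by (auto simp: P_def pairwise_insert)
    moreover have "x \<notin> S" using far assms(2) by force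
    ultimately show False using S(2)[of "insert x S"] fin[OF S(1)] by simp
  qed
  then have "covered_by_balls X X \<delta> (card S)"
    unfolding covered_by_balls_def using S(1) fin[OF S(1)] P_def by blast
  then show thesis
    using that[of S] S(1) fin[OF S(1)] covering_number_le P_def by blast
qed

section \<open>Upper box dimension as the growth exponent of covering numbers\<close>

lemma eventually_at_right_0_less: "c > 0 \<Longrightarrow> \<forall>\<^sub>F \<delta> in at_right 0. 0 < \<delta> \<and> \<delta> < (c::real)"
  unfolding eventually_at_right_field by auto

lemma eventually_at_right_0_divide:
  assumes "\<forall>\<^sub>F \<delta> in at_right (0::real). P \<delta>" "k > 0"
  shows "\<forall>\<^sub>F \<delta> in at_right 0. P (\<delta> / k)"
proof -
  obtain b where b: "b > 0" "\<And>\<delta>. 0 < \<delta> \<Longrightarrow> \<delta> < b \<Longrightarrow> P \<delta>"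
    using assms(1) unfolding eventually_at_right_field by auto
  have "\<forall>\<^sub>F \<delta> in at_right (0::real). 0 < \<delta> \<and> \<delta> < b * k"
    by (rule eventually_at_right_0_less) (use b assms(2) in simp)
  then show ?thesis
    by eventually_elim (use assms(2) in \<open>auto intro!: b(2) simp: pos_divide_less_eq\<close>)
qed

lemma upper_box_dim_lessD:
  assumes "totally_bounded X" "X \<noteq> {}" "upper_box_dim X < ereal c"
  shows "\<forall>\<^sub>F \<delta> in at_right 0. real (covering_number X \<delta>) \<le> \<delta> powr (- c)"
proof -
  have "\<forall>\<^sub>F \<delta> in at_right 0. ereal (ln (real (covering_number X \<delta>)) / ln (1 / \<delta>)) < ereal c"
    using assms by (intro Limsup_lessD) (simp add: upper_box_dim_def)
  moreover have "\<forall>\<^sub>F \<delta> in at_right (0::real). 0 < \<delta> \<and> \<delta> < 1"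
    by (rule eventually_at_right_0_less) simp
  ultimately show ?thesis
  proof eventually_elim
    case (elim \<delta>)
    then have L: "ln (1 / \<delta>) > 0" and L': "ln (1 / \<delta>) = - ln \<delta>"
      by (auto simp: ln_div)
    have pos: "real (covering_number X \<delta>) > 0"
      using covering_number_ge_1[OF assms(1) _ assms(2), of \<delta>] elim by simp
    have "ln (real (covering_number X \<delta>)) \<le> c * ln (1 / \<delta>)"
      using elim L by (simp add: divide_less_eq)
    also have "\<dots> = ln (\<delta> powr (- c))"
      using elim L' by (simp add: ln_powr)
    finally show ?case using pos elim by (subst (asm) ln_le_cancel_iff) auto
  qed
qed

text \<open>A multiplicative constant adds \<open>K = ln (max C 1)\<close> to the logarithm, which
  \<open>(c' - c) * ln (1 / \<delta>)\<close> exceeds for small \<open>\<delta>\<close>, whatever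
  \<open>c' > c\<close>.\<close>

lemma upper_box_dim_leI:
  assumes "totally_bounded X" "X \<noteq> {}"
    and ev: "\<forall>\<^sub>F \<delta> in at_right 0. real (covering_number X \<delta>) \<le> C * \<delta> powr (- c)"
  shows "upper_box_dim X \<le> ereal c"
proof -
  have "\<forall>\<^sub>F \<delta> in at_right 0. ereal (ln (real (covering_number X \<delta>)) / ln (1 / \<delta>)) < y"
    if y: "ereal c < y" for y
  proof -
    obtain c' where c': "c < c'" "ereal c' < y" using ereal_dense2[OF y] by auto
    define K where "K = ln (max C 1)"
    have "\<forall>\<^sub>F \<delta> in at_right (0::real). 0 < \<delta> \<and> \<delta> < min 1 (exp (- (K / (c' - c))))"
      by (rule eventually_at_right_0_less) simp
    with ev show ?thesis
    proof eventually_elim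
      case (elim \<delta>)
      then have d: "0 < \<delta>" "\<delta> < 1" "\<delta> < exp (- (K / (c' - c)))" by auto
      then have L: "ln (1 / \<delta>) > 0" and L': "ln (1 / \<delta>) = - ln \<delta>"
        by (auto simp: ln_div)
      have "ln \<delta> < - (K / (c' - c))" using d by (metis exp_less_cancel_iff exp_ln)
      then have K: "K < (c' - c) * ln (1 / \<delta>)"
        using c'(1) by (simp add: L' field_simps)
      have pos: "real (covering_number X \<delta>) > 0"
        using covering_number_ge_1[OF assms(1) d(1) assms(2)] by simp
      have "real (covering_number X \<delta>) \<le> max C 1 * \<delta> powr (- c)"
        using elim by (smt (verit) mult_right_mono powr_ge_zero)
      then have "ln (real (covering_number X \<delta>)) \<le> ln (max C 1 * \<delta> powr (- c))"
        using pos d by (subst ln_le_cancel_iff) auto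
      also have "\<dots> = K + c * ln (1 / \<delta>)"
        using d by (simp add: ln_mult K_def ln_powr L')
      also have "\<dots> \<le> c' * ln (1 / \<delta>)" using K by (simp add: algebra_simps)
      finally have "ln (real (covering_number X \<delta>)) / ln (1 / \<delta>) \<le> c'"
        using L by (simp add: divide_le_eq)
      then show ?case using c'(2) by (meson ereal_less_eq(3) le_less_trans)
    qed
  qed
  then show ?thesis
    using assms(1,2) by (simp add: upper_box_dim_def Limsup_le_iff)
qed

lemma less_upper_box_dimD:
  assumes "totally_bounded X" "X \<noteq> {}" "ereal c < upper_box_dim X"
  shows "\<exists>\<^sub>F \<delta> in at_right 0. \<delta> powr (- c) < real (covering_number X \<delta>)"
proof (rule ccontr)
  assume "\<not> ?thesis"
  then have "\<forall>\<^sub>F \<delta> in at_right 0. real (covering_number X \<delta>) \<le> 1 * \<delta> powr (- c)"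
    by (simp add: frequently_def not_less)
  then show False using upper_box_dim_leI[OF assms(1,2)] assms(3) by (meson not_less)
qed

text \<open>Arbitrarily small scales suffice, the dimension being an upper limit: were it below
  \<open>c\<close>, some \<open>c' < c\<close> would bound the covering numbers by
  \<open>\<delta> powr (- c')\<close> at all small scales.\<close>

lemma le_upper_box_dimI:
  assumes "totally_bounded X" "X \<noteq> {}"
    and fr: "\<exists>\<^sub>F \<delta> in at_right 0. \<delta> powr (- c) \<le> real (covering_number X \<delta>)"
  shows "ereal c \<le> upper_box_dim X"
proof (rule ccontr)
  assume "\<not> ?thesis"
  then have "upper_box_dim X < ereal c" by (rule not_le_imp_less)
  then obtain c' where c': "upper_box_dim X < ereal c'" "c' < c"
    using ereal_dense2 by (metis ereal_less(3) less_ereal.simps(1))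
  have "\<forall>\<^sub>F \<delta> in at_right (0::real). 0 < \<delta> \<and> \<delta> < 1"
    by (rule eventually_at_right_0_less) simp
  with upper_box_dim_lessD[OF assms(1,2) c'(1)]
  have "\<forall>\<^sub>F \<delta> in at_right 0. \<not> \<delta> powr (- c) \<le> real (covering_number X \<delta>)"
  proof eventually_elim
    case (elim \<delta>)
    have "\<delta> powr (- c') < \<delta> powr (- c)"
      using elim c'(2) by (simp add: powr_less_mono')
    then show ?case using elim by simp
  qed
  then show False using fr by (simp add: frequently_def)
qed

lemma upper_box_dim_nonneg:
  assumes "X \<noteq> {}" shows "0 \<le> upper_box_dim X"
proof (cases "totally_bounded X")
  case True
  have "\<forall>\<^sub>F \<delta> in at_right (0::real). 0 < \<delta> \<and> \<delta> < 1"
    by (rule eventually_at_right_0_less) simp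
  then have "\<forall>\<^sub>F \<delta> in at_right 0. \<delta> powr (- 0) \<le> real (covering_number X \<delta>)"
  proof eventually_elim
    case (elim \<delta>)
    then show ?case using covering_number_ge_1[OF True _ assms, of \<delta>] by simp
  qed
  then have "\<exists>\<^sub>F \<delta> in at_right 0. \<delta> powr (- 0) \<le> real (covering_number X \<delta>)"
    by (intro eventually_frequently) (auto simp: trivial_limit_at_right_real)
  from le_upper_box_dimI[OF True assms this] show ?thesis by (simp add: zero_ereal_def)
qed (use assms in \<open>simp add: upper_box_dim_def\<close>)

lemma upper_box_dim_finite_le_0:
  assumes "finite X" shows "upper_box_dim X \<le> 0"
proof (cases "X = {}")
  case False
  have tb: "totally_bounded X"
    unfolding totally_bounded_metric using assms by (intro allI impI exI[of _ X]) auto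
  have "\<forall>\<^sub>F \<delta> in at_right (0::real). 0 < \<delta> \<and> \<delta> < 1"
    by (rule eventually_at_right_0_less) simp
  then have "\<forall>\<^sub>F \<delta> in at_right 0. real (covering_number X \<delta>) \<le> real (card X) * \<delta> powr (- 0)"
  proof eventually_elim
    case (elim \<delta>)
    have "covered_by_balls X X \<delta> (card X)"
      unfolding covered_by_balls_def using assms elim by (intro exI[of _ X]) auto
    then show ?case using covering_number_le elim by auto
  qed
  from upper_box_dim_leI[OF tb False this] show ?thesis by (simp add: zero_ereal_def)
qed (simp add: upper_box_dim_def)

text \<open>Reduces dimension inequalities to real exponents, so that an infinite \<open>y\<close>
  needs no case of its own.\<close>

lemma ereal_le_reals: "(\<And>c. y < ereal c \<Longrightarrow> x \<le> ereal c) \<Longrightarrow> x \<le> (y::ereal)"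
  by (rule ccontr) (use ereal_dense2[of y x] in \<open>fastforce simp: not_le\<close>)

lemma powr_scale: "0 < (\<delta>::real) \<Longrightarrow> 0 < k \<Longrightarrow> (\<delta> / k) powr (- c) = k powr c * \<delta> powr (- c)"
  by (simp add: powr_divide powr_minus field_simps)

text \<open>A finite union of closed balls that covers \<open>Y\<close> is closed and so covers
  \<open>closure Y\<close>. Recentring in \<open>Z\<close> doubles the radius, which only affects
  the constant \<open>2 powr c\<close>. The lemma serves both for monotonicity and for passing to
  closures.\<close>

lemma upper_box_dim_closure_mono:
  assumes tb: "totally_bounded Y" "totally_bounded Z" and Z: "Z \<subseteq> closure Y"
  shows "upper_box_dim Z \<le> upper_box_dim Y"
proof (cases "Z = {}")
  case True
  then show ?thesis
    using upper_box_dim_nonneg[of Y]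
    by (cases "Y = {}") (auto simp: upper_box_dim_def intro: order_trans[of "-1" 0])
next
  case False
  then have Y: "Y \<noteq> {}" using Z by auto
  show ?thesis
  proof (rule ereal_le_reals)
    fix c assume c: "upper_box_dim Y < ereal c"
    have "\<forall>\<^sub>F \<delta> in at_right 0. real (covering_number Y (\<delta> / 2)) \<le> (\<delta> / 2) powr (- c)"
      using eventually_at_right_0_divide[OF upper_box_dim_lessD[OF tb(1) Y c], of 2] by simp
    moreover have "\<forall>\<^sub>F \<delta> in at_right (0::real). 0 < \<delta> \<and> \<delta> < 1"
      by (rule eventually_at_right_0_less) simp
    ultimately have "\<forall>\<^sub>F \<delta> in at_right 0. real (covering_number Z \<delta>) \<le> 2 powr c * \<delta> powr (- c)"
    proof eventually_elim
      case (elim \<delta>)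
      obtain C where C: "finite C" "card C \<le> covering_number Y (\<delta> / 2)"
          "Y \<subseteq> (\<Union>c\<in>C. cball c (\<delta> / 2))"
        using covering_number_covers[OF tb(1), of "\<delta> / 2"] elim
        unfolding covered_by_balls_def by auto
      have "closure Y \<subseteq> (\<Union>c\<in>C. cball c (\<delta> / 2))"
        using C by (intro closure_minimal closed_UN) auto
      with Z have "Z \<subseteq> (\<Union>c\<in>C. cball c (\<delta> / 2))" by blast
      from covered_by_balls_recentre[OF this C(1,2)]
      have "covering_number Z \<delta> \<le> covering_number Y (\<delta> / 2)"
        by (intro covering_number_le) simp
      then show ?case using elim by (simp add: powr_scale)
    qed
    then show "upper_box_dim Z \<le> ereal c"
      by (rule upper_box_dim_leI[OF tb(2) False])
  qed
qed

section \<open>Graphs\<close>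

definition graph_over :: "('a \<Rightarrow> 'b) \<Rightarrow> 'a set \<Rightarrow> ('a \<times> 'b) set" where
  "graph_over f A = (\<lambda>x. (x, f x)) ` A"

lemma fun_graph_eq: "fun_graph f = graph_over f UNIV"
  by (auto simp: fun_graph_def graph_over_def)

lemma graph_over_mono: "A \<subseteq> B \<Longrightarrow> graph_over f A \<subseteq> graph_over f B"
  by (auto simp: graph_over_def)

lemma graph_over_empty_iff [simp]: "graph_over f A = {} \<longleftrightarrow> A = {}"
  by (simp add: graph_over_def)

section \<open>Upper box dimension of the graph over a piece\<close>

text \<open>In a grid of mesh \<open>\<delta> / d\<close>, rounding every coordinate down moves a
  point by at most \<open>\<delta>\<close> in the sum norm, which dominates the Euclidean one.
  Because of \<open>\<delta> \<le> 1\<close>, additive constants are absorbed into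
  \<open>1 / \<delta>\<close>, leaving at most \<open>(2 * R * d + 5) / \<delta>\<close> values per
  coordinate.\<close>

lemma cball_grid_cover:
  fixes R :: real
  assumes "R > 0" "0 < \<delta>" "\<delta> \<le> 1"
  obtains D :: "(real ^ 'd) set" where "finite D" "cball 0 R \<subseteq> (\<Union>c\<in>D. cball c \<delta>)"
    "real (card D) \<le> (2 * R * CARD('d) + 5) ^ CARD('d) * \<delta> powr (- real CARD('d))"
proof -
  let ?d = "real CARD('d)"
  define L where "L = \<lceil>R * ?d / \<delta>\<rceil> + 1"
  define G :: "('d \<Rightarrow> int) \<Rightarrow> real ^ 'd" where "G k = (\<chi> i. \<delta> / ?d * real_of_int (k i))" for k
  let ?F = "(UNIV::'d set) \<rightarrow>\<^sub>E {-L..L}"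
  have d: "?d > 0" by simp
  have pos: "R * ?d / \<delta> > 0" using assms d by simp
  then have L0: "L \<ge> 1" unfolding L_def by (simp add: less_imp_le)
  have fin: "finite ?F" by (intro finite_PiE) auto
  have cover: "cball 0 R \<subseteq> (\<Union>c\<in>G ` ?F. cball c \<delta>)"
  proof
    fix w :: "real ^ 'd" assume "w \<in> cball 0 R"
    then have w: "norm w \<le> R" by simp
    define k where "k i = \<lfloor>w $ i * ?d / \<delta>\<rfloor>" for i
    have "k i \<in> {-L..L}" for i
    proof -
      have "\<bar>w $ i\<bar> \<le> R" using component_le_norm_cart[of w i] w by simp
      then have "\<bar>w $ i * ?d / \<delta>\<bar> \<le> R * ?d / \<delta>"
        using assms d by (simp add: abs_mult divide_right_mono mult_right_mono)
      then have "w $ i * ?d / \<delta> \<le> R * ?d / \<delta>" "- (R * ?d / \<delta>) \<le> w $ i * ?d / \<delta>"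
        by linarith+
      then show ?thesis unfolding k_def L_def atLeastAtMost_iff by linarith
    qed
    then have k: "k \<in> ?F" by auto
    have "norm (G k - w) \<le> (\<Sum>i\<in>UNIV. \<bar>(G k - w) $ i\<bar>)" by (rule norm_le_l1_cart)
    also have "\<dots> \<le> (\<Sum>i\<in>(UNIV::'d set). \<delta> / ?d)"
    proof (rule sum_mono)
      fix i
      have "\<bar>real_of_int (k i) - w $ i * ?d / \<delta>\<bar> \<le> 1" unfolding k_def by linarith
      then have "\<delta> / ?d * \<bar>real_of_int (k i) - w $ i * ?d / \<delta>\<bar> \<le> \<delta> / ?d * 1"
        using assms d by (intro mult_left_mono) auto
      moreover have "\<delta> / ?d * \<bar>real_of_int (k i) - w $ i * ?d / \<delta>\<bar>
          = \<bar>\<delta> / ?d * (real_of_int (k i) - w $ i * ?d / \<delta>)\<bar>"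
        using assms d by (simp add: abs_mult)
      moreover have "\<delta> / ?d * (real_of_int (k i) - w $ i * ?d / \<delta>) = (G k - w) $ i"
        using assms d by (simp add: G_def field_simps)
      ultimately show "\<bar>(G k - w) $ i\<bar> \<le> \<delta> / ?d" by (metis mult.right_neutral)
    qed
    also have "\<dots> = \<delta>" by simp
    finally show "w \<in> (\<Union>c\<in>G ` ?F. cball c \<delta>)"
      using k by (auto simp: dist_norm)
  qed
  have "card (G ` ?F) \<le> card ?F" using fin by (rule card_image_le)
  also have "\<dots> = (nat (2 * L + 1)) ^ CARD('d)"
    by (simp add: card_PiE algebra_simps)
  finally have "real (card (G ` ?F)) \<le> real (nat (2 * L + 1) ^ CARD('d))" by (rule of_nat_mono)
  also have "\<dots> = (2 * real_of_int L + 1) ^ CARD('d)"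
    using L0 by simp
  also have "\<dots> \<le> ((2 * R * ?d + 5) / \<delta>) ^ CARD('d)"
  proof (rule power_mono)
    have "real_of_int L \<le> R * ?d / \<delta> + 2" unfolding L_def by linarith
    then have "2 * real_of_int L + 1 \<le> 2 * (R * ?d / \<delta>) + 5 * 1" by linarith
    also have "\<dots> \<le> 2 * (R * ?d / \<delta>) + 5 * (1 / \<delta>)"
      using assms by (intro add_left_mono mult_left_mono) auto
    finally show "2 * real_of_int L + 1 \<le> (2 * R * ?d + 5) / \<delta>" by (simp add: add_divide_distrib)
  qed (use L0 in auto)
  also have "\<dots> = (2 * R * ?d + 5) ^ CARD('d) * \<delta> powr (- ?d)"
    using assms by (simp add: power_divide powr_minus powr_realpow field_simps)
  finally show thesis using that[of "G ` ?F"] fin cover by blast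
qed

text \<open>Covers of \<open>A\<close> and of a ball containing all values, both with radius
  \<open>\<delta> / 4\<close>, multiply to a cover of the graph with radius
  \<open>\<delta> / 2\<close>; recentring makes it \<open>\<delta>\<close>. Cardinalities multiply,
  so exponents add.\<close>

lemma upper_box_dim_graph_over_le:
  fixes f :: "'a::metric_space \<Rightarrow> real ^ 'd"
  assumes tb: "totally_bounded A" "totally_bounded (graph_over f A)"
    and A: "A \<noteq> {}" and R: "\<And>x. norm (f x) \<le> R"
  shows "upper_box_dim (graph_over f A) \<le> upper_box_dim A + ereal (real CARD('d))"
proof -
  let ?d = "real CARD('d)"
  define R' where "R' = max R 1"
  have R': "R' > 0" "\<And>x. norm (f x) \<le> R'"
    using R by (auto simp: R'_def intro: max.coboundedI1)
  have "upper_box_dim (graph_over f A) - ereal ?d \<le> upper_box_dim A"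
  proof (rule ereal_le_reals)
    fix c assume c: "upper_box_dim A < ereal c"
    define K where "K = (2 * R' * ?d + 5) ^ CARD('d)"
    have "\<forall>\<^sub>F \<delta> in at_right 0. real (covering_number A (\<delta> / 4)) \<le> (\<delta> / 4) powr (- c)"
      using eventually_at_right_0_divide[OF upper_box_dim_lessD[OF tb(1) A c], of 4] by simp
    moreover have "\<forall>\<^sub>F \<delta> in at_right (0::real). 0 < \<delta> \<and> \<delta> < 1"
      by (rule eventually_at_right_0_less) simp
    ultimately have "\<forall>\<^sub>F \<delta> in at_right 0. real (covering_number (graph_over f A) \<delta>)
        \<le> (4 powr (c + ?d) * K) * \<delta> powr (- (c + ?d))"
    proof eventually_elim
      case (elim \<delta>)
      obtain C where C: "finite C" "card C \<le> covering_number A (\<delta> / 4)"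
          "A \<subseteq> (\<Union>c\<in>C. cball c (\<delta> / 4))"
        using covering_number_covers[OF tb(1), of "\<delta> / 4"] elim
        unfolding covered_by_balls_def by auto
      obtain D :: "(real ^ 'd) set" where D: "finite D" "cball 0 R' \<subseteq> (\<Union>c\<in>D. cball c (\<delta> / 4))"
        "real (card D) \<le> K * (\<delta> / 4) powr (- ?d)"
        using cball_grid_cover[OF R'(1), of "\<delta> / 4"] elim unfolding K_def by auto
      have "graph_over f A \<subseteq> (\<Union>c\<in>C \<times> D. cball c (\<delta> / 2))"
      proof
        fix z assume "z \<in> graph_over f A"
        then obtain x where x: "x \<in> A" "z = (x, f x)" by (auto simp: graph_over_def)
        obtain p where p: "p \<in> C" "dist p x \<le> \<delta> / 4" using C(3) x by auto
        obtain q where q: "q \<in> D" "dist q (f x) \<le> \<delta> / 4" using D(2) R'(2)[of x] by auto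
        have "dist (p, q) z \<le> dist p x + dist q (f x)"
          unfolding x(2) dist_Pair_Pair by (rule sqrt_sum_squares_le_sum) auto
        also have "\<dots> \<le> \<delta> / 2" using p q by simp
        finally have "z \<in> cball (p, q) (\<delta> / 2)" by simp
        then show "z \<in> (\<Union>c\<in>C \<times> D. cball c (\<delta> / 2))" using p(1) q(1) by blast
      qed
      from covered_by_balls_recentre[OF this _ order_refl] C(1) D(1)
      have "covering_number (graph_over f A) \<delta> \<le> card (C \<times> D)"
        by (intro covering_number_le) auto
      then have "real (covering_number (graph_over f A) \<delta>) \<le> real (card C) * real (card D)"
        by (metis card_cartesian_product of_nat_le_iff of_nat_mult)
      also have "\<dots> \<le> (\<delta> / 4) powr (- c) * (K * (\<delta> / 4) powr (- ?d))"
        using C(2) D(3) elim by (intro mult_mono) auto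
      also have "\<dots> = (4 powr (c + ?d) * K) * \<delta> powr (- (c + ?d))"
        using elim powr_scale[of \<delta> 4 c] powr_scale[of \<delta> 4 ?d]
          powr_add[of \<delta> "- c" "- ?d"] powr_add[of 4 c ?d]
        by (simp add: mult_ac)
      finally show ?case .
    qed
    from upper_box_dim_leI[OF tb(2) _ this] A
    have "upper_box_dim (graph_over f A) \<le> ereal c + ereal ?d" by simp
    then show "upper_box_dim (graph_over f A) - ereal ?d \<le> ereal c"
      by (subst ereal_minus_le_iff) (auto simp: add.commute)
  qed
  then show ?thesis
    by (subst (asm) ereal_minus_le_iff) (auto simp: add.commute)
qed

section \<open>Reduction to the upper box dimension of portions\<close>

lemma totally_bounded_compact:
  assumes "compact K" "A \<subseteq> (K :: 'a::metric_space set)" shows "totally_bounded A"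
proof (rule totally_bounded_subset[OF _ assms(2)])
  show "totally_bounded K"
    using assms(1) unfolding compact_eq_totally_bounded totally_bounded_metric ball_def by blast
qed

lemma compact_graph_over:
  assumes "compact A" "continuous_on A f" shows "compact (graph_over f A)"
  unfolding graph_over_def
  by (intro compact_continuous_image continuous_intros assms)

section \<open>Upper bound for the packing dimension of a graph\<close>

lemma packing_dim_le: "X = (\<Union>i. Y i) \<Longrightarrow> packing_dim X \<le> (SUP i::nat. upper_box_dim (Y i))"
  unfolding packing_dim_def by (intro Inf_lower CollectI exI[of _ Y]) simp

lemma packing_dim_graph_le:
  fixes f :: "'k::metric_space \<Rightarrow> real ^ 'd"
  assumes K: "compact (UNIV :: 'k set)" and f: "continuous_on UNIV f"
  shows "packing_dim (graph_over f UNIV) \<le> packing_dim (UNIV :: 'k set) + ereal (real CARD('d))"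
proof -
  let ?d = "ereal (real CARD('d))"
  obtain R where R: "\<And>x. norm (f x) \<le> R"
    using compact_imp_bounded[OF compact_continuous_image[OF f K]] by (auto simp: bounded_iff)
  have "packing_dim (graph_over f UNIV) - ?d \<le> packing_dim (UNIV :: 'k set)"
    unfolding packing_dim_def[of UNIV]
  proof (rule Inf_greatest, clarify)
    fix Y :: "nat \<Rightarrow> 'k set" assume Y: "UNIV = (\<Union>i. Y i)"
    let ?s = "SUP i. upper_box_dim (Y i)"
    \<comment> \<open>One piece is non-empty, so the supremum is at least 0; this takes care of the
      value -1 that empty pieces contribute.\<close>
    obtain j where "Y j \<noteq> {}" using Y by blast
    then have s0: "0 \<le> ?s"
      using upper_box_dim_nonneg[of "Y j"] by (intro SUP_upper2[of j]) auto
    have "graph_over f UNIV = (\<Union>i. graph_over f (Y i))"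
      by (subst Y) (simp add: graph_over_def image_UN)
    then have "packing_dim (graph_over f UNIV) \<le> (SUP i. upper_box_dim (graph_over f (Y i)))"
      by (rule packing_dim_le)
    also have "\<dots> \<le> ?s + ?d"
    proof (rule SUP_least)
      fix i
      show "upper_box_dim (graph_over f (Y i)) \<le> ?s + ?d"
      proof (cases "Y i = {}")
        case True
        have "- 1 \<le> (0::ereal)" by simp
        also have "0 \<le> ?s + ?d" using s0 by (rule add_nonneg_nonneg) simp
        finally show ?thesis using True by (simp add: upper_box_dim_def)
      next
        case False
        have "upper_box_dim (graph_over f (Y i)) \<le> upper_box_dim (Y i) + ?d"
          using K False R compact_graph_over[OF K f] graph_over_mono[of "Y i" UNIV f]
          by (intro upper_box_dim_graph_over_le[of _ _ R]) (auto intro: totally_bounded_compact)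
        also have "\<dots> \<le> ?s + ?d" by (intro add_right_mono SUP_upper) simp
        finally show ?thesis .
      qed
    qed
    finally show "packing_dim (graph_over f UNIV) - ?d \<le> ?s"
      by (subst ereal_minus_le_iff) (auto simp: add.commute)
  qed
  then show ?thesis by (subst (asm) ereal_minus_le_iff) (auto simp: add.commute)
qed

section \<open>Lower bound by Baire category\<close>

text \<open>A countable cover of the graph induces sets \<open>E i\<close> in \<open>F\<close> whose
  closures cover \<open>F\<close>. By Baire's theorem one of these closures contains a portion
  \<open>F \<inter> U\<close>, and continuity puts the graph over that portion into
  \<open>closure (Y i)\<close>, whose upper box dimension is no larger than that of
  \<open>Y i\<close>.\<close>

lemma le_packing_dim_graph:
  fixes f :: "'k::metric_space \<Rightarrow> 'b::metric_space"
  assumes K: "compact (UNIV :: 'k set)" and f: "continuous_on UNIV f"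
    and F: "closed F" "F \<noteq> {}"
    and le: "\<And>U. open U \<Longrightarrow> F \<inter> U \<noteq> {} \<Longrightarrow> T \<le> upper_box_dim (graph_over f (F \<inter> U))"
  shows "T \<le> packing_dim (graph_over f UNIV)"
  unfolding packing_dim_def
proof (rule Inf_greatest, clarify)
  fix Y :: "nat \<Rightarrow> ('k \<times> 'b) set" assume Y: "graph_over f UNIV = (\<Union>i. Y i)"
  define E where "E i = {x \<in> F. (x, f x) \<in> Y i}" for i
  let ?X = "top_of_set F"
  have EF: "closure (E i) \<subseteq> F" for i
    using F(1) by (intro closure_minimal) (auto simp: E_def)
  have cover: "(\<Union>i. closure (E i)) = F"
  proof
    show "F \<subseteq> (\<Union>i. closure (E i))"
    proof
      fix x assume x: "x \<in> F"
      have "(x, f x) \<in> (\<Union>i. Y i)" using Y by (auto simp: graph_over_def)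
      then show "x \<in> (\<Union>i. closure (E i))"
        using x closure_subset by (fastforce simp: E_def)
    qed
  qed (use EF in auto)
  have "compact F" using K F(1) by (metis compact_Int_closed inf_top_left)
  then have "locally_compact_space ?X \<and> regular_space ?X"
    by (simp add: compact_imp_locally_compact_space compact_space_subtopology
        metrizable_imp_regular_space metrizable_space_euclidean metrizable_space_subtopology)
  then have X: "completely_metrizable_space ?X \<or> locally_compact_space ?X \<and> regular_space ?X" ..
  have "?X interior_of (\<Union>(range (\<lambda>i. closure (E i)))) = {}"
    if "\<forall>i. ?X interior_of closure (E i) = {}"
  proof (rule Baire_category_alt[OF X])
    fix T assume "T \<in> range (\<lambda>i. closure (E i))"
    then obtain i where "T = closure (E i)" by blast
    then show "closedin ?X T \<and> ?X interior_of T = {}"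
      using that closed_subset[OF EF closed_closure] by simp
  qed auto
  moreover have "?X interior_of (\<Union>(range (\<lambda>i. closure (E i)))) = F"
    using interior_of_topspace[of ?X] by (simp add: cover)
  ultimately have "\<exists>i. ?X interior_of closure (E i) \<noteq> {}" using F(2) by auto
  then obtain i x where x: "x \<in> ?X interior_of closure (E i)" by blast
  obtain U where U: "open U" "?X interior_of closure (E i) = F \<inter> U"
    using openin_interior_of[of ?X "closure (E i)"] 
    unfolding openin_open by blast
  have sub: "F \<inter> U \<subseteq> closure (E i)" using U(2) interior_of_subset by metis
  have tb: "totally_bounded Z" if "Z \<subseteq> graph_over f UNIV" for Z
    using totally_bounded_compact[OF compact_graph_over[OF K f]] that .
  have "graph_over f (F \<inter> U) \<subseteq> closure (graph_over f (E i))"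
  proof -
    have "continuous_on (closure (E i)) (\<lambda>x. (x, f x))"
      by (intro continuous_intros continuous_on_subset[OF f]) simp
    then have "graph_over f (closure (E i)) \<subseteq> closure (graph_over f (E i))"
      unfolding graph_over_def by (rule image_closure_subset) (auto intro: subsetD[OF closure_subset])
    then show ?thesis using graph_over_mono[OF sub] by blast
  qed
  moreover have "graph_over f (E i) \<subseteq> Y i" by (auto simp: graph_over_def E_def)
  ultimately have "graph_over f (F \<inter> U) \<subseteq> closure (Y i)" using closure_mono by blast
  then have "upper_box_dim (graph_over f (F \<inter> U)) \<le> upper_box_dim (Y i)"
    using Y by (intro upper_box_dim_closure_mono tb graph_over_mono) auto
  moreover have "T \<le> upper_box_dim (graph_over f (F \<inter> U))" using U x by (intro le) auto
  ultimately show "T \<le> (SUP i. upper_box_dim (Y i))" by (meson SUP_upper2 UNIV_I order_trans)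
qed

text \<open>Compactness gives finite nets of radius \<open>1 / Suc n\<close>; the balls of these
  radii around the net points form a countable basis.\<close>

lemma compact_countable_basis:
  assumes "compact (UNIV :: 'k::metric_space set)"
  obtains \<B> :: "'k::metric_space set set" where "countable \<B>" "\<And>B. B \<in> \<B> \<Longrightarrow> open B"
    "\<And>U x. open U \<Longrightarrow> x \<in> U \<Longrightarrow> \<exists>B\<in>\<B>. x \<in> B \<and> B \<subseteq> U"
proof -
  have "\<exists>C. finite C \<and> (UNIV :: 'k set) \<subseteq> (\<Union>c\<in>C. ball c (1 / Suc n))" for n
    using compact_eq_totally_bounded[of "UNIV :: 'k set"] assms by simp
  then obtain C where C: "\<And>n. finite (C n)" "\<And>n. (UNIV :: 'k set) \<subseteq> (\<Union>c\<in>C n. ball c (1 / Suc n))"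
    by metis
  define \<B> where "\<B> = (\<Union>n. (\<lambda>c. ball c (1 / Suc n)) ` C n)"
  have "\<exists>B\<in>\<B>. x \<in> B \<and> B \<subseteq> U" if U: "open U" "x \<in> U" for U and x :: 'k
  proof -
    obtain e where e: "e > 0" "ball x e \<subseteq> U" using U openE by blast
    obtain n where n: "1 / real (Suc n) < e / 2"
      using e(1) nat_approx_posE[of "e / 2"] by auto
    have "x \<in> (\<Union>c\<in>C n. ball c (1 / Suc n))" using C(2)[of n] by blast
    then obtain c where c: "c \<in> C n" "dist c x < 1 / Suc n" by auto
    have "ball c (1 / Suc n) \<subseteq> ball x e"
    proof
      fix y assume "y \<in> ball c (1 / Suc n)"
      then show "y \<in> ball x e" using c(2) n dist_triangle3[of x y c] by simp
    qed
    then show ?thesis using c e(2) by (intro bexI[of _ "ball c (1 / Suc n)"]) (auto simp: \<B>_def)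
  qed
  moreover have "countable \<B>" unfolding \<B>_def by (simp add: C(1) countable_finite)
  moreover have "\<And>B. B \<in> \<B> \<Longrightarrow> open B" by (auto simp: \<B>_def)
  ultimately show thesis using that by blast
qed

section \<open>A closed set all of whose portions are large\<close>

text \<open>The \<open>small\<close> sets form a sigma-ideal that does not contain the whole space.
  The union \<open>V\<close> of all small basis sets is the largest small open set. If a non-empty
  portion of the complement were small, then so would be the open set \<open>U\<close> cutting it
  out, and \<open>U\<close> would already lie in \<open>V\<close>.\<close>

lemma closed_kernel_with_large_portions:
  assumes K: "compact (UNIV :: 'k::metric_space set)" and unc: "uncountable (UNIV :: 'k set)"
    and t: "ereal t < packing_dim (UNIV :: 'k set)"
  obtains F :: "'k::metric_space set" where "closed F" "F \<noteq> {}"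
    "\<And>U. open U \<Longrightarrow> F \<inter> U \<noteq> {} \<Longrightarrow> infinite (F \<inter> U) \<and> ereal t < upper_box_dim (F \<inter> U)"
proof -
  define small where "small E \<longleftrightarrow> (\<exists>Y::nat \<Rightarrow> 'k set. E \<subseteq> (\<Union>i. Y i) \<and>
    (\<forall>i. finite (Y i) \<or> upper_box_dim (Y i) \<le> ereal t))" for E
  have small_mono: "small D" if "small E" "D \<subseteq> E" for D E
    using that unfolding small_def by (meson subset_trans)
  have small_Union: "small (\<Union>\<E>)" if "countable \<E>" "\<And>E. E \<in> \<E> \<Longrightarrow> small E" for \<E>
  proof (cases "\<E> = {}")
    case True
    then show ?thesis by (auto simp: small_def intro!: exI[of _ "\<lambda>_. {}"])
  next
    case False
    then have r: "range (from_nat_into \<E>) = \<E>" using that(1) by (rule range_from_nat_into)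
    have "\<forall>n. small (from_nat_into \<E> n)" using that(2) False by (simp add: from_nat_into)
    then obtain Y where Y: "\<And>n. from_nat_into \<E> n \<subseteq> (\<Union>i::nat. Y n i)"
        "\<And>n i. finite (Y n i) \<or> upper_box_dim (Y n i) \<le> ereal t"
      unfolding small_def by metis
    have "\<Union>\<E> \<subseteq> (\<Union>m. (\<lambda>(n, i). Y n i) (prod_decode m))"
    proof
      fix x assume "x \<in> \<Union>\<E>"
      then obtain n where "x \<in> from_nat_into \<E> n" using r by (metis UnionE rangeE)
      then obtain i where "x \<in> Y n i" using Y(1) by blast
      then show "x \<in> (\<Union>m. (\<lambda>(n, i). Y n i) (prod_decode m))"
        by (intro UN_I[of "prod_encode (n, i)"]) auto
    qed
    then show ?thesis
      unfolding small_def using Y(2)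
      by (intro exI[of _ "\<lambda>m. (\<lambda>(n, i). Y n i) (prod_decode m)"]) (simp add: case_prod_beta)
  qed
  have not_small_UNIV: "\<not> small UNIV"
  proof
    assume "small UNIV"
    then obtain Y :: "nat \<Rightarrow> 'k set" where UY: "UNIV \<subseteq> (\<Union>i::nat. Y i) \<and>
        (\<forall>i. finite (Y i) \<or> upper_box_dim (Y i) \<le> ereal t)"
      unfolding small_def by blast
    then have Y: "\<And>i. finite (Y i) \<or> upper_box_dim (Y i) \<le> ereal t" by (elim conjE allE)
    have UY': "(\<Union>i. Y i) = UNIV" using conjunct1[OF UY] by (rule top.extremum_uniqueI)
    show False
    \<comment> \<open>For negative \<open>t\<close> only the empty set has dimension at most
      \<open>t\<close>, so all pieces are finite and the space would be countable. Otherwise finite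
      pieces have dimension at most \<open>0 \<le> t\<close>, and the packing dimension would be at
      most \<open>t\<close>.\<close>
    proof (cases "t < 0")
      case True
      have "finite (Y i)" for i
      proof (rule ccontr)
        assume inf: "infinite (Y i)"
        then have "Y i \<noteq> {}" "upper_box_dim (Y i) \<le> ereal t" using Y[of i] by auto
        then have "0 \<le> ereal t" using upper_box_dim_nonneg order_trans by blast
        then show False using True by (simp add: zero_ereal_def)
      qed
      then have "countable (\<Union>i. Y i)" by (simp add: countable_finite)
      then show False using unc by (simp add: UY')
    next
      case False
      have "packing_dim (UNIV :: 'k set) \<le> (SUP i. upper_box_dim (Y i))"
        using UY'[symmetric] by (rule packing_dim_le)
      also have "\<dots> \<le> ereal t"
      proof (rule SUP_least)
        fix i
        have "0 \<le> ereal t" using False by (simp add: zero_ereal_def)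
        then show "upper_box_dim (Y i) \<le> ereal t"
          using Y[of i] upper_box_dim_finite_le_0[of "Y i"] by (meson order_trans)
      qed
      finally show False using t by simp
    qed
  qed
  obtain \<B> :: "'k set set" where \<B>: "countable \<B>" "\<And>B. B \<in> \<B> \<Longrightarrow> open B"
    "\<And>U x. open U \<Longrightarrow> x \<in> U \<Longrightarrow> \<exists>B\<in>\<B>. x \<in> B \<and> B \<subseteq> U"
    using compact_countable_basis[OF K] by blast
  define V where "V = \<Union>{B \<in> \<B>. small B}"
  have "open V" unfolding V_def using \<B>(2) by auto
  have "countable {B \<in> \<B>. small B}" using \<B>(1) by (rule countable_subset[rotated]) auto
  then have V: "small V" unfolding V_def by (rule small_Union) auto
  have small_open: "U \<subseteq> V" if U: "open U" "small U" for U
  proof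
    fix x assume "x \<in> U"
    then obtain B where "B \<in> \<B>" "x \<in> B" "B \<subseteq> U" using \<B>(3) U(1) by blast
    then show "x \<in> V" unfolding V_def using small_mono[OF U(2)] by blast
  qed
  have not_small: "\<not> small (- V \<inter> U)" if U: "open U" "- V \<inter> U \<noteq> {}" for U
  proof
    assume "small (- V \<inter> U)"
    then have "small (\<Union>{- V \<inter> U, V})" using V by (intro small_Union) auto
    then have "small U" by (rule small_mono) blast
    then show False using small_open[OF U(1)] U(2) by blast
  qed
  have notsmallD: "infinite E \<and> ereal t < upper_box_dim E" if "\<not> small E" for E
  proof -
    have "\<not> (finite E \<or> upper_box_dim E \<le> ereal t)"
    proof
      assume "finite E \<or> upper_box_dim E \<le> ereal t"
      then have "small E" unfolding small_def by (intro exI[of _ "\<lambda>_. E"]) auto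
      then show False using that by blast
    qed
    then show ?thesis by auto
  qed
  show thesis
  proof (rule that[of "- V"])
    show "closed (- V)" using \<open>open V\<close> by (simp add: closed_Compl)
    show "- V \<noteq> {}" using V not_small_UNIV by (metis Compl_UNIV_eq double_compl)
    show "infinite (- V \<inter> U) \<and> ereal t < upper_box_dim (- V \<inter> U)"
      if "open U" "- V \<inter> U \<noteq> {}" for U
      using not_small[OF that] by (rule notsmallD)
  qed
qed

section \<open>Finite configurations at a single scale\<close>

text \<open>The vectors form a cubical grid of side \<open>L\<close> and mesh
  \<open>5 * \<delta>\<close>, so two of them differ by at least \<open>5 * \<delta>\<close> in some
  coordinate.\<close>

lemma separated_vectors:
  assumes "\<delta> > 0"
  obtains V :: "(real ^ 'd) set" where "finite V" "card V = L ^ CARD('d)"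
    "pairwise (\<lambda>u v. dist u v > 4 * \<delta>) V"
    "\<And>v. v \<in> V \<Longrightarrow> norm v \<le> 5 * real CARD('d) * \<delta> * real L"
proof -
  define G :: "('d \<Rightarrow> nat) \<Rightarrow> real ^ 'd" where "G k = (\<chi> i. 5 * \<delta> * real (k i))" for k
  let ?F = "(UNIV::'d set) \<rightarrow>\<^sub>E {..<L}"
  have sep: "dist (G k) (G l) > 4 * \<delta>" if "k \<noteq> l" for k l
  proof -
    obtain i where i: "k i \<noteq> l i" using \<open>k \<noteq> l\<close> by (auto simp: fun_eq_iff)
    then have "1 \<le> \<bar>real (k i) - real (l i)\<bar>" by linarith
    then have "5 * \<delta> * 1 \<le> 5 * \<delta> * \<bar>real (k i) - real (l i)\<bar>"
      using assms by (intro mult_left_mono) auto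
    also have "\<dots> = \<bar>(G k - G l) $ i\<bar>"
      using assms by (simp add: G_def abs_mult flip: right_diff_distrib)
    also have "\<dots> \<le> dist (G k) (G l)" unfolding dist_norm by (rule component_le_norm_cart)
    finally show ?thesis using assms by simp
  qed
  have inj: "inj G"
  proof (rule injI, rule ccontr)
    fix k l assume "G k = G l" "k \<noteq> l"
    then show False using sep[of k l] assms by simp
  qed
  show thesis
  proof (rule that[of "G ` ?F"])
    show "finite (G ` ?F)" by (intro finite_imageI finite_PiE) auto
    show "card (G ` ?F) = L ^ CARD('d)"
      by (subst card_image) (auto intro: inj_on_subset[OF inj] simp: card_PiE)
    show "pairwise (\<lambda>u v. dist u v > 4 * \<delta>) (G ` ?F)"
      unfolding pairwise_image using sep by (auto simp: pairwise_def)
    fix v assume "v \<in> G ` ?F"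
    then obtain k where k: "k \<in> ?F" "v = G k" by blast
    have "norm v \<le> (\<Sum>i\<in>UNIV. \<bar>v $ i\<bar>)" by (rule norm_le_l1_cart)
    also have "\<dots> \<le> (\<Sum>i\<in>(UNIV::'d set). 5 * \<delta> * real L)"
    proof (rule sum_mono)
      fix i
      have "k i < L" using k(1) by auto
      then show "\<bar>v $ i\<bar> \<le> 5 * \<delta> * real L" using assms by (simp add: k(2) G_def)
    qed
    also have "\<dots> = 5 * real CARD('d) * \<delta> * real L" by simp
    finally show "norm v \<le> 5 * real CARD('d) * \<delta> * real L" .
  qed
qed

text \<open>Around each of about \<open>\<delta> powr - t\<close> separated centres, about \<open>\<delta> powr - d\<close> points of \<open>A\<close> are placed;
  \<open>V\<close> is a grid with a few times more vectors. Independent values from \<open>V\<close> therefore separate most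
  of the points over a common centre.\<close>

lemma ex_configuration:
  fixes A :: "'k::metric_space set" and m :: nat
  assumes tb: "totally_bounded A" and A: "A \<noteq> {}"
    and inf: "\<And>x r. x \<in> A \<Longrightarrow> r > 0 \<Longrightarrow> infinite (A \<inter> ball x r)"
    and t: "ereal t < upper_box_dim A"
    and pos: "\<eta> > 0" "a > 0" "\<epsilon> > 0" "m > 0"
  obtains \<delta> P and V :: "(real ^ 'd) set" where "0 < \<delta>" "\<delta> < \<epsilon>" "finite P" "P \<subseteq> A" "finite V"
    "\<forall>p\<in>P. m * card {q \<in> P. dist p q \<le> 2 * \<delta>} \<le> card V"
    "2 * \<delta> powr (- (t + real CARD('d) - \<eta>)) \<le> real (card P)"
    "pairwise (\<lambda>u v. dist u v > 4 * \<delta>) V" "\<forall>v\<in>V. norm v \<le> a"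
proof -
  let ?d = "real CARD('d)"
  have d: "?d \<ge> 1" by (simp add: Suc_le_eq)
  \<comment> \<open>The constant in the bound \<open>\<kappa> * \<delta> powr (- d) \<le> M\<close>
    on the number of points per centre. The 10 allows for rounding in \<open>L\<close>, the 2 for
    rounding in the division by \<open>m\<close>.\<close>
  define \<kappa> where "\<kappa> = (a / (10 * ?d)) ^ CARD('d) / (2 * real m)"
  have \<kappa>: "\<kappa> > 0" using pos d by (simp add: \<kappa>_def)
  \<comment> \<open>The second bound makes the grid side at least \<open>2 * m\<close>. The third
    makes \<open>\<delta> powr \<eta>\<close> at most \<open>\<kappa> * 8 powr (- t) / 2\<close>, so
    that the loss \<open>\<eta>\<close> in the exponent absorbs all constants.\<close>
  define b where "b = Min {\<epsilon>, a / (20 * ?d * real m), (\<kappa> * 8 powr (- t) / 2) powr (1 / \<eta>)}"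
  have b: "b > 0" using pos \<kappa> d by (simp add: b_def)
  have "\<forall>\<^sub>F r in at_right 0. 0 < r \<and> r < 8 * b"
    by (rule eventually_at_right_0_less) (use b in simp)
  with less_upper_box_dimD[OF tb A t]
  have "\<exists>\<^sub>F r in at_right 0. (0 < r \<and> r < 8 * b) \<and> r powr (- t) < real (covering_number A r)"
    by (rule frequently_eventually_conj)
  then obtain r where r: "r powr (- t) < real (covering_number A r)" "0 < r" "r < 8 * b"
    by (auto dest!: frequently_ex)
  \<comment> \<open>Centres more than \<open>r\<close> apart with clusters of radius
    \<open>r / 4\<close> leave more than \<open>r / 2 = 4 * \<delta>\<close> between different
    clusters, which exceeds the required \<open>2 * \<delta>\<close>.\<close>
  define \<delta> where "\<delta> = r / 8"
  have \<delta>: "0 < \<delta>" "\<delta> < \<epsilon>" "\<delta> \<le> a / (20 * ?d * real m)"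
      "\<delta> \<le> (\<kappa> * 8 powr (- t) / 2) powr (1 / \<eta>)"
  proof -
    have "\<delta> < b" using r by (simp add: \<delta>_def)
    moreover have "b \<le> \<epsilon>" "b \<le> a / (20 * ?d * real m)" "b \<le> (\<kappa> * 8 powr (- t) / 2) powr (1 / \<eta>)"
      unfolding b_def by (intro Min_le; simp)+
    ultimately show "\<delta> < \<epsilon>" "\<delta> \<le> a / (20 * ?d * real m)"
      "\<delta> \<le> (\<kappa> * 8 powr (- t) / 2) powr (1 / \<eta>)" by linarith+
    show "0 < \<delta>" using r by (simp add: \<delta>_def)
  qed
  \<comment> \<open>The largest side for which the norm bound \<open>5 * d * \<delta> * L\<close>
    stays within \<open>a\<close>. The number \<open>M\<close> of points per centre is then the
    largest one with \<open>m * M \<le> card V\<close>.\<close>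
  define L where "L = nat \<lfloor>a / (5 * ?d * \<delta>)\<rfloor>"
  define M where "M = L ^ CARD('d) div m"
  obtain V :: "(real ^ 'd) set" where V: "finite V" "card V = L ^ CARD('d)"
    "pairwise (\<lambda>u v. dist u v > 4 * \<delta>) V"
    "\<And>v. v \<in> V \<Longrightarrow> norm v \<le> 5 * ?d * \<delta> * real L"
    using separated_vectors[OF \<delta>(1)] by blast
  obtain S where S: "finite S" "S \<subseteq> A" "pairwise (\<lambda>x y. dist x y > r) S"
    "covering_number A r \<le> card S"
    using separated_set_ge_covering_number[OF tb r(2)] by blast
  \<comment> \<open>Every neighbourhood of \<open>s\<close> contains infinitely many points of
    \<open>A\<close>, so a cluster of any prescribed size fits near \<open>s\<close>.\<close>
  have "\<exists>T. finite T \<and> card T = M \<and> T \<subseteq> A \<inter> ball s (r / 4)" if "s \<in> S" for s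
    by (rule infinite_arbitrarily_large) (use inf[of s "r / 4"] that S(2) r(2) in auto)
  then obtain T where T: "\<And>s. s \<in> S \<Longrightarrow> finite (T s)" "\<And>s. s \<in> S \<Longrightarrow> card (T s) = M"
    "\<And>s. s \<in> S \<Longrightarrow> T s \<subseteq> A \<inter> ball s (r / 4)" by metis
  define P where "P = (\<Union>s\<in>S. T s)"
  have far: "dist p q > 2 * \<delta>" if "s \<in> S" "s' \<in> S" "s \<noteq> s'" "p \<in> T s" "q \<in> T s'" for s s' p q
  proof -
    have "r < dist s s'" using that S(3) by (auto simp: pairwise_def)
    also have "\<dots> \<le> dist s p + (dist p q + dist q s')"
      using dist_triangle[of s s' p] dist_triangle[of p s' q] by simp
    finally have "r < dist s p + (dist p q + dist q s')" .
    moreover have "dist s p < r / 4" "dist q s' < r / 4"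
      using subsetD[OF T(3)[OF that(1)] that(4)] subsetD[OF T(3)[OF that(2)] that(5)]
      by (simp_all add: dist_commute)
    ultimately show ?thesis using r(2) unfolding \<delta>_def by linarith
  qed
  have disj: "T s \<inter> T s' = {}" if "s \<in> S" "s' \<in> S" "s \<noteq> s'" for s s'
    using far[OF that] \<delta>(1) by force
  have cardP: "card P = card S * M"
    unfolding P_def using S(1) T(1,2) disj by (subst card_UN_disjoint) auto
  have x2: "a / (5 * ?d * \<delta>) \<ge> 4 * real m"
    using \<delta>(1,3) pos d by (simp add: field_simps)
  have L: "a / (10 * ?d * \<delta>) \<le> real L" "2 * real m \<le> real L" "real L \<le> a / (5 * ?d * \<delta>)"
  proof -
    have fl: "a / (5 * ?d * \<delta>) - 1 \<le> real L" "real L \<le> a / (5 * ?d * \<delta>)"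
      using x2 pos unfolding L_def by linarith+
    have "a / (10 * ?d * \<delta>) = (a / (5 * ?d * \<delta>)) / 2" by simp
    moreover have "real m \<ge> 1" using pos by simp
    ultimately show "a / (10 * ?d * \<delta>) \<le> real L" "2 * real m \<le> real L" "real L \<le> a / (5 * ?d * \<delta>)"
      using fl x2 by linarith+
  qed
  \<comment> \<open>Rounding a quotient that is at least 2 down to an integer loses at most half of
    it.\<close>
  have half_le: "x / 2 \<le> y" if "x - 1 \<le> y" "2 \<le> x" for x y :: real using that by linarith
  have M: "\<kappa> * \<delta> powr (- ?d) \<le> real M"
  proof -
    have "1 \<le> L" using L(2) pos by linarith
    then have "L ^ 1 \<le> L ^ CARD('d)" by (intro power_increasing) (simp_all add: Suc_le_eq)
    then have "real L \<le> real (L ^ CARD('d))" by (simp del: of_nat_power)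
    then have 2: "2 * real m \<le> real (L ^ CARD('d))" using L(2) by linarith
    have "real (L ^ CARD('d)) / real m - 1 \<le> real M"
    proof -
      have "L ^ CARD('d) \<le> m * M + m"
        unfolding M_def using mod_less_divisor[OF pos(4), of "L ^ CARD('d)"]
          mult_div_mod_eq[of m "L ^ CARD('d)"] by linarith
      then have "real (L ^ CARD('d)) \<le> real (m * M + m)" by (rule of_nat_mono)
      then have "real (L ^ CARD('d)) / real m \<le> real (m * M + m) / real m"
        by (rule divide_right_mono) simp
      also have "\<dots> = real M + 1" using pos by (simp add: field_simps)
      finally show ?thesis by simp
    qed
    moreover have "real (L ^ CARD('d)) / real m \<ge> 2" using 2 pos by (simp add: pos_le_divide_eq)
    ultimately have "real (L ^ CARD('d)) / real m / 2 \<le> real M"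
      by (rule half_le)
    moreover have "\<kappa> * \<delta> powr (- ?d) = (a / (10 * ?d * \<delta>)) ^ CARD('d) / real m / 2"
      using \<delta>(1) by (simp add: \<kappa>_def power_divide power_mult_distrib powr_minus powr_realpow field_simps)
    moreover have "(a / (10 * ?d * \<delta>)) ^ CARD('d) \<le> real (L ^ CARD('d))"
      using L(1) pos \<delta>(1) d by (simp add: power_mono)
    ultimately show ?thesis
      using pos by (smt (verit) divide_right_mono of_nat_0_le_iff)
  qed
  show thesis
  proof (rule that[OF \<delta>(1,2) _ _ V(1) _ _ V(3)])
    show "finite P" unfolding P_def using S(1) T(1) by auto
    show "P \<subseteq> A" unfolding P_def using T(3) by auto
    show "\<forall>v\<in>V. norm v \<le> a"
    proof
      fix v assume "v \<in> V"
      then have "norm v \<le> 5 * ?d * \<delta> * real L" by (rule V(4))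
      also have "\<dots> \<le> 5 * ?d * \<delta> * (a / (5 * ?d * \<delta>))"
        using L(3) \<delta>(1) by (intro mult_left_mono) auto
      also have "\<dots> = a" using \<delta>(1) d by simp
      finally show "norm v \<le> a" .
    qed
    show "\<forall>p\<in>P. m * card {q \<in> P. dist p q \<le> 2 * \<delta>} \<le> card V"
    proof
      fix p assume "p \<in> P"
      then obtain s where s: "s \<in> S" "p \<in> T s" using P_def by auto
      have "{q \<in> P. dist p q \<le> 2 * \<delta>} \<subseteq> T s"
        using far[OF s(1) _ _ s(2)] unfolding P_def by fastforce
      then have "card {q \<in> P. dist p q \<le> 2 * \<delta>} \<le> M"
        using T(1,2)[OF s(1)] card_mono by metis
      then have "m * card {q \<in> P. dist p q \<le> 2 * \<delta>} \<le> m * M" by (rule mult_le_mono2)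
      also have "\<dots> \<le> card V" unfolding M_def V(2) by simp
      finally show "m * card {q \<in> P. dist p q \<le> 2 * \<delta>} \<le> card V" .
    qed
    have "\<delta> powr \<eta> \<le> ((\<kappa> * 8 powr (- t) / 2) powr (1 / \<eta>)) powr \<eta>"
      using \<delta>(1,4) pos by (intro powr_mono2) auto
    then have "\<delta> powr \<eta> \<le> \<kappa> * 8 powr (- t) / 2"
      using pos \<kappa> by (simp add: powr_powr)
    then have "2 * \<delta> powr \<eta> * \<delta> powr (- (t + ?d)) \<le> \<kappa> * 8 powr (- t) * \<delta> powr (- (t + ?d))"
      by (intro mult_right_mono) auto
    also have "\<dots> = (8 * \<delta>) powr (- t) * (\<kappa> * \<delta> powr (- ?d))"
      using \<delta>(1) by (simp add: powr_mult powr_add[symmetric])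
    also have "\<dots> \<le> real (card S) * real M"
      using M r(1) S(4) \<kappa> by (intro mult_mono) (auto simp: \<delta>_def)
    finally show "2 * \<delta> powr (- (t + ?d - \<eta>)) \<le> real (card P)"
      using \<delta>(1) by (simp add: cardP powr_add[symmetric] algebra_simps)
  qed
qed

section \<open>Random continuous functions\<close>

lemma continuous_on_eval_bcontfun: "continuous_on S (\<lambda>f. apply_bcontfun f x)"
  unfolding continuous_on_iff
  by (meson dist_fun_lt_imp_dist_val_lt)

instance bcontfun :: (metric_space, banach) banach ..

lemma apply_bcontfun_sum: "apply_bcontfun (\<Sum>i\<in>I. f i) x = (\<Sum>i\<in>I. apply_bcontfun (f i) x)"
  for f :: "'i \<Rightarrow> 'a::topological_space \<Rightarrow>\<^sub>C 'b::real_normed_vector"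
  by (induction I rule: infinite_finite_induct) auto

definition tent :: "real \<Rightarrow> 'a::metric_space \<Rightarrow> 'b::real_normed_vector \<Rightarrow> 'a \<Rightarrow>\<^sub>C 'b" where
  "tent \<rho> p v = Bcontfun (\<lambda>x. max 0 (1 - dist x p / \<rho>) *\<^sub>R v)"

lemma apply_tent:
  assumes "\<rho> > 0"
  shows "apply_bcontfun (tent \<rho> p v) x = max 0 (1 - dist x p / \<rho>) *\<^sub>R v"
proof -
  have "(\<lambda>x. max 0 (1 - dist x p / \<rho>) *\<^sub>R v) \<in> bcontfun"
  proof (rule bcontfun_normI[of _ "norm v"])
    show "continuous_on UNIV (\<lambda>x. max 0 (1 - dist x p / \<rho>) *\<^sub>R v)"
      using assms by (intro continuous_intros) auto
    show "norm (max 0 (1 - dist x p / \<rho>) *\<^sub>R v) \<le> norm v" for x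
      using assms by (auto simp: intro!: mult_left_le_one_le)
  qed
  then show ?thesis by (simp add: tent_def Bcontfun_inverse)
qed

section \<open>Conditioning on all but one coordinate\<close>

text \<open>Resampling coordinate \<open>i\<close> independently leaves the product law unchanged.
  By Fubini the measure of \<open>E\<close> is then an average, over the other coordinates, of the
  proportion of values in \<open>V i\<close> that lead into \<open>E\<close>.\<close>

lemma measure_PiM_uniform_le:
  fixes V :: "'i \<Rightarrow> 'v set"
  assumes V: "\<And>j. finite (V j)" "\<And>j. V j \<noteq> {}"
    and E: "E \<in> sets (PiM UNIV (\<lambda>j. uniform_count_measure (V j)))"
    and le: "\<And>X. X \<in> space (PiM UNIV (\<lambda>j. uniform_count_measure (V j))) \<Longrightarrow>
      card {v \<in> V i. X(i := v) \<in> E} \<le> 1"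
  shows "measure (PiM UNIV (\<lambda>j. uniform_count_measure (V j))) E \<le> 1 / real (card (V i))"
proof -
  let ?U = "\<lambda>j. uniform_count_measure (V j)"
  let ?M = "PiM UNIV ?U"
  let ?g = "\<lambda>(v, X). X(i := v)"
  have prob: "prob_space (?U j)" for j using V by (rule prob_space_uniform_count_measure)
  interpret Ui: prob_space "?U i" by (rule prob)
  interpret M: prob_space ?M using prob by (intro prob_space_PiM) auto
  interpret pair_sigma_finite "?U i" ?M ..
  have g: "?g \<in> ?U i \<Otimes>\<^sub>M ?M \<rightarrow>\<^sub>M ?M"
    using measurable_fun_upd[of UNIV UNIV i snd "?U i \<Otimes>\<^sub>M ?M" ?U fst]
    by (simp add: case_prod_beta')
  have "distr (?U i \<Otimes>\<^sub>M ?M) ?M ?g = ?M"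
    using distr_pair_PiM_eq_PiM[of UNIV ?U i] prob by simp
  then have "emeasure ?M E = emeasure (distr (?U i \<Otimes>\<^sub>M ?M) ?M ?g) E" by simp
  also have "\<dots> = emeasure (?U i \<Otimes>\<^sub>M ?M) (?g -` E \<inter> space (?U i \<Otimes>\<^sub>M ?M))"
    using g E by (rule emeasure_distr)
  also have "\<dots> = (\<integral>\<^sup>+X. emeasure (?U i) ((\<lambda>v. (v, X)) -` (?g -` E \<inter> space (?U i \<Otimes>\<^sub>M ?M))) \<partial>?M)"
    using measurable_sets[OF g E] by (rule emeasure_pair_measure_alt2)
  also have "\<dots> \<le> (\<integral>\<^sup>+X. ennreal (1 / real (card (V i))) \<partial>?M)"
  proof (rule nn_integral_mono)
    fix X assume X: "X \<in> space ?M"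
    have "(\<lambda>v. (v, X)) -` (?g -` E \<inter> space (?U i \<Otimes>\<^sub>M ?M)) = {v \<in> V i. X(i := v) \<in> E}"
      using X by (auto simp: space_pair_measure space_uniform_count_measure)
    moreover have "real (card {v \<in> V i. X(i := v) \<in> E}) / real (card (V i)) \<le> 1 / real (card (V i))"
      using le[OF X] by (intro divide_right_mono) auto
    ultimately show "emeasure (?U i) ((\<lambda>v. (v, X)) -` (?g -` E \<inter> space (?U i \<Otimes>\<^sub>M ?M)))
        \<le> ennreal (1 / real (card (V i)))"
      using V(1)[of i] by (simp add: emeasure_uniform_count_measure ennreal_leI)
  qed
  also have "\<dots> = ennreal (1 / real (card (V i)))" by (simp add: M.emeasure_space_1)
  finally have "ennreal (measure ?M E) \<le> ennreal (1 / real (card (V i)))"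
    by (simp add: M.emeasure_eq_measure)
  then show ?thesis by (subst (asm) ennreal_le_iff) simp_all
qed

text \<open>The random function \<open>\<Psi> \<omega>\<close> takes at level \<open>n\<close> independent, uniformly distributed
  values in \<open>V n\<close> on the points of \<open>P n\<close>, interpolated by tents with disjoint supports.\<close>

locale random_tents =
  fixes P :: "nat \<Rightarrow> 'k::metric_space set" and V :: "nat \<Rightarrow> 'v::banach set" and \<rho> :: "nat \<Rightarrow> real"
  assumes finite_P: "finite (P n)" and finite_V: "finite (V n)" and V_nonempty: "V n \<noteq> {}"
    and norm_V: "v \<in> V n \<Longrightarrow> norm v \<le> (1 / 2) ^ n"
    and \<rho>_pos: "\<rho> n > 0"
    and \<rho>_separated: "p \<in> P n \<Longrightarrow> q \<in> P n \<Longrightarrow> p \<noteq> q \<Longrightarrow> 2 * \<rho> n \<le> dist p q"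
begin

definition \<Omega> :: "(nat \<times> 'k \<Rightarrow> 'v) measure" where
  "\<Omega> = PiM UNIV (\<lambda>i. uniform_count_measure (V (fst i)))"

definition \<Phi> :: "nat \<Rightarrow> (nat \<times> 'k \<Rightarrow> 'v) \<Rightarrow> 'k \<Rightarrow>\<^sub>C 'v" where
  "\<Phi> n \<omega> = (\<Sum>p\<in>P n. tent (\<rho> n) p (\<omega> (n, p)))"

definition \<Psi> :: "(nat \<times> 'k \<Rightarrow> 'v) \<Rightarrow> 'k \<Rightarrow>\<^sub>C 'v" where
  "\<Psi> \<omega> = (\<Sum>n. \<Phi> n \<omega>)"

lemma space_\<Omega>: "\<omega> \<in> space \<Omega> \<longleftrightarrow> (\<forall>n p. \<omega> (n, p) \<in> V n)"
  by (auto simp: \<Omega>_def space_PiM space_uniform_count_measure PiE_iff)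

sublocale prob_space \<Omega>
  unfolding \<Omega>_def
  by (intro prob_space_PiM prob_space_uniform_count_measure finite_V V_nonempty)

section \<open>Convergence and measurability of the random series\<close>

text \<open>Since the centres are at least \<open>2 * \<rho> n\<close> apart, at most one tent is
  non-zero at any given point, so amplitudes within a level do not add up.\<close>

lemma norm_\<Phi>_le:
  assumes "\<omega> \<in> space \<Omega>"
  shows "norm (\<Phi> n \<omega>) \<le> (1 / 2) ^ n"
proof (rule norm_bound)
  fix x :: 'k
  have zero: "apply_bcontfun (tent (\<rho> n) p v) x = 0" if "\<rho> n \<le> dist x p" for p and v :: 'v
    using that \<rho>_pos[of n] by (simp add: apply_tent max_def)
  show "norm (apply_bcontfun (\<Phi> n \<omega>) x) \<le> (1 / 2) ^ n"
  proof (cases "\<exists>p\<in>P n. dist x p < \<rho> n")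
    case True
    then obtain p where p: "p \<in> P n" "dist x p < \<rho> n" by blast
    have "\<rho> n \<le> dist x q" if "q \<in> P n - {p}" for q
      using \<rho>_separated[of p n q] p that dist_triangle3[of p q x] by auto
    then have "(\<Sum>q\<in>P n - {p}. apply_bcontfun (tent (\<rho> n) q (\<omega> (n, q))) x) = 0"
      by (intro sum.neutral ballI zero)
    then have "apply_bcontfun (\<Phi> n \<omega>) x = apply_bcontfun (tent (\<rho> n) p (\<omega> (n, p))) x"
      using p(1) finite_P[of n] by (simp add: \<Phi>_def apply_bcontfun_sum sum.remove)
    also have "norm \<dots> \<le> norm (\<omega> (n, p))"
      using \<rho>_pos[of n] by (auto simp: apply_tent intro!: mult_left_le_one_le)
    also have "\<dots> \<le> (1 / 2) ^ n" using assms by (intro norm_V) (simp add: space_\<Omega>)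
    finally show ?thesis .
  next
    case False
    then have "apply_bcontfun (\<Phi> n \<omega>) x = 0"
      by (simp add: \<Phi>_def apply_bcontfun_sum zero not_less)
    then show ?thesis by simp
  qed
qed

lemma summable_\<Phi>: "\<omega> \<in> space \<Omega> \<Longrightarrow> summable (\<lambda>n. \<Phi> n \<omega>)"
  by (rule summable_comparison_test'[of "\<lambda>n. (1 / 2) ^ n" 0]) (simp_all add: norm_\<Phi>_le)

text \<open>Without a countable base, sums of Borel functions are delicate. Partial sums depend on
  finitely many coordinates with finitely many values each, so they are measurable even for the
  discrete sigma-algebra, where adding a term is harmless. Borel measurability is only invoked for
  the pointwise limit.\<close>

lemma \<Psi>_measurable [measurable]: "\<Psi> \<in> borel_measurable \<Omega>"
proof -
  have coord: "(\<lambda>\<omega>. \<omega> (n, p)) \<in> \<Omega> \<rightarrow>\<^sub>M count_space (V n)" for n p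
  proof -
    have "(\<lambda>\<omega>. \<omega> (n, p)) \<in> \<Omega> \<rightarrow>\<^sub>M uniform_count_measure (V n)"
      unfolding \<Omega>_def
      using measurable_component_singleton[of "(n, p)" UNIV "\<lambda>i. uniform_count_measure (V (fst i))"]
      by simp
    then show ?thesis
      using measurable_cong_sets[OF refl sets_uniform_count_measure_count_space] by blast
  qed
  have add: "(\<lambda>\<omega>. S \<omega> + (\<Sum>p\<in>Q. tent (\<rho> n) p (\<omega> (n, p)))) \<in> \<Omega> \<rightarrow>\<^sub>M count_space UNIV"
    if "S \<in> \<Omega> \<rightarrow>\<^sub>M count_space UNIV" "finite Q" for S :: "_ \<Rightarrow> 'k \<Rightarrow>\<^sub>C 'v" and Q n
    using that(2)
  proof (induction Q rule: finite_induct)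
    case empty
    then show ?case using that(1) by simp
  next
    case (insert p Q)
    have "(\<lambda>\<omega>. (S \<omega> + (\<Sum>p\<in>Q. tent (\<rho> n) p (\<omega> (n, p)))) + tent (\<rho> n) p (\<omega> (n, p)))
        \<in> \<Omega> \<rightarrow>\<^sub>M count_space UNIV"
    proof (rule measurable_compose_countable'[where I = "V n" and g = "\<lambda>\<omega>. \<omega> (n, p)" and
          f = "\<lambda>v \<omega>. (S \<omega> + (\<Sum>p\<in>Q. tent (\<rho> n) p (\<omega> (n, p)))) + tent (\<rho> n) p v", OF _ coord])
      show "countable (V n)" using finite_V by (rule countable_finite)
      show "(\<lambda>\<omega>. (S \<omega> + (\<Sum>p\<in>Q. tent (\<rho> n) p (\<omega> (n, p)))) + tent (\<rho> n) p v)
          \<in> \<Omega> \<rightarrow>\<^sub>M count_space UNIV" for v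
        using measurable_compose[OF insert.IH, of "\<lambda>s. s + tent (\<rho> n) p v"] by simp
    qed
    then show ?case using insert.hyps by (simp add: add_ac)
  qed
  have partial: "(\<lambda>\<omega>. \<Sum>n<N. \<Phi> n \<omega>) \<in> \<Omega> \<rightarrow>\<^sub>M count_space UNIV" for N
  proof (induction N)
    case (Suc N)
    then show ?case using add[OF Suc finite_P, of N N] by (simp add: \<Phi>_def)
  qed simp
  show ?thesis
  proof (rule borel_measurable_LIMSEQ_metric)
    show "(\<lambda>\<omega>. \<Sum>n<N. \<Phi> n \<omega>) \<in> borel_measurable \<Omega>" for N
      using measurable_compose[OF partial, of "\<lambda>s. s" borel] by simp
    show "(\<lambda>N. \<Sum>n<N. \<Phi> n \<omega>) \<longlonglongrightarrow> \<Psi> \<omega>" if "\<omega> \<in> space \<Omega>" for \<omega>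
      unfolding \<Psi>_def using summable_\<Phi>[OF that] by (rule summable_LIMSEQ)
  qed
qed

text \<open>A tent is linear in its height, and a change at \<open>(n, p)\<close> affects no other
  summand and no other level.\<close>

lemma \<Psi>_update:
  assumes \<omega>: "\<omega> \<in> space \<Omega>" and p: "p \<in> P n" and v: "v \<in> V n"
  shows "\<Psi> (fun_upd \<omega> (n, p) v) = \<Psi> \<omega> + tent (\<rho> n) p (v - \<omega> (n, p))"
proof -
  let ?\<omega>' = "fun_upd \<omega> (n, p) v"
  have \<omega>': "?\<omega>' \<in> space \<Omega>" using \<omega> v by (auto simp: space_\<Omega>)
  have "\<Phi> m ?\<omega>' - \<Phi> m \<omega> = (if m = n then tent (\<rho> n) p (v - \<omega> (n, p)) else 0)" for m
  proof (cases "m = n")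
    case True
    have "(\<Sum>q\<in>P n - {p}. tent (\<rho> n) q (?\<omega>' (n, q))) = (\<Sum>q\<in>P n - {p}. tent (\<rho> n) q (\<omega> (n, q)))"
      by (intro sum.cong) auto
    then have "\<Phi> n ?\<omega>' - \<Phi> n \<omega> = tent (\<rho> n) p v - tent (\<rho> n) p (\<omega> (n, p))"
      unfolding \<Phi>_def using p finite_P[of n] by (simp add: sum.remove)
    also have "\<dots> = tent (\<rho> n) p (v - \<omega> (n, p))"
      using \<rho>_pos[of n] by (intro bcontfun_eqI) (simp add: apply_tent scaleR_diff_right)
    finally show ?thesis using True by simp
  next
    case False
    then show ?thesis by (simp add: \<Phi>_def)
  qed
  then have "(\<lambda>m. \<Phi> m ?\<omega>' - \<Phi> m \<omega>) sums tent (\<rho> n) p (v - \<omega> (n, p))"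
    using sums_single[of n "\<lambda>_. tent (\<rho> n) p (v - \<omega> (n, p))"] by simp
  moreover have "(\<lambda>m. \<Phi> m ?\<omega>' - \<Phi> m \<omega>) sums (\<Psi> ?\<omega>' - \<Psi> \<omega>)"
    unfolding \<Psi>_def by (intro sums_diff summable_sums summable_\<Phi> \<omega> \<omega>')
  ultimately have "tent (\<rho> n) p (v - \<omega> (n, p)) = \<Psi> ?\<omega>' - \<Psi> \<omega>" by (rule sums_unique2)
  then show ?thesis by simp
qed

text \<open>With all coordinates except \<open>(n, p)\<close> fixed, the value at \<open>q\<close>
  is fixed too, because the tent at \<open>p\<close> vanishes there, while the value at
  \<open>p\<close> is shifted by the new choice. Closeness confines this choice to a ball of radius
  \<open>c\<close>, which contains at most one vector of \<open>V n\<close>.\<close>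

lemma prob_close_pair_le:
  assumes pq: "p \<in> P n" "q \<in> P n" "p \<noteq> q"
    and sep: "pairwise (\<lambda>u v. dist u v > 2 * c) (V n)"
  shows "{\<omega> \<in> space \<Omega>. dist (apply_bcontfun (\<Psi> \<omega> + g) p) (apply_bcontfun (\<Psi> \<omega> + g) q) \<le> c} \<in> sets \<Omega>" (is "?E \<in> _")
    and "prob {\<omega> \<in> space \<Omega>. dist (apply_bcontfun (\<Psi> \<omega> + g) p) (apply_bcontfun (\<Psi> \<omega> + g) q) \<le> c} \<le> 1 / real (card (V n))"
proof -
  have "closed {f. dist (apply_bcontfun (f + g) p) (apply_bcontfun (f + g) q) \<le> c}"
    by (simp, intro closed_Collect_le continuous_intros continuous_on_eval_bcontfun)
  then have "\<Psi> -` {f. dist (apply_bcontfun (f + g) p) (apply_bcontfun (f + g) q) \<le> c} \<inter> space \<Omega> \<in> sets \<Omega>"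
    by (intro measurable_sets[OF \<Psi>_measurable]) simp
  moreover have "\<Psi> -` {f. dist (apply_bcontfun (f + g) p) (apply_bcontfun (f + g) q) \<le> c} \<inter> space \<Omega> = ?E" by auto
  ultimately show E: "?E \<in> sets \<Omega>" by simp
  have "card {v \<in> V n. fun_upd \<omega> (n, p) v \<in> ?E} \<le> 1" if \<omega>: "\<omega> \<in> space \<Omega>" for \<omega>
  proof -
    \<comment> \<open>The choice at \<open>(n, p)\<close> for which the images of \<open>p\<close>
      and \<open>q\<close> would coincide.\<close>
    define y where "y = apply_bcontfun (\<Psi> \<omega> + g) q - apply_bcontfun (\<Psi> \<omega> + g) p + \<omega> (n, p)"
    have close: "dist v y \<le> c" if "v \<in> V n" "fun_upd \<omega> (n, p) v \<in> ?E" for v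
    proof -
      have "dist (apply_bcontfun (\<Psi> (fun_upd \<omega> (n, p) v) + g) p) (apply_bcontfun (\<Psi> (fun_upd \<omega> (n, p) v) + g) q) \<le> c"
        using that(2) by blast
      moreover have "\<rho> n \<le> dist q p"
        using \<rho>_separated[OF pq] \<rho>_pos[of n] by (simp add: dist_commute)
      ultimately show ?thesis
        using \<rho>_pos[of n]
        by (simp add: \<Psi>_update[OF \<omega> pq(1) that(1)] apply_tent y_def dist_norm algebra_simps)
    qed
    have "u = v" if "u \<in> V n" "fun_upd \<omega> (n, p) u \<in> ?E" "v \<in> V n" "fun_upd \<omega> (n, p) v \<in> ?E" for u v
    proof (rule ccontr)
      assume "u \<noteq> v"
      then have "2 * c < dist u v" using sep that(1,3) by (simp add: pairwise_def)
      also have "\<dots> \<le> dist u y + dist v y" by (rule dist_triangle2)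
      finally show False using close[OF that(1,2)] close[OF that(3,4)] by simp
    qed
    then show ?thesis
      using card_le_Suc0_iff_eq[of "{v \<in> V n. fun_upd \<omega> (n, p) v \<in> ?E}"] finite_V[of n] by auto
  qed
  then show "prob ?E \<le> 1 / real (card (V n))"
    using measure_PiM_uniform_le[of "\<lambda>i. V (fst i)" ?E "(n, p)"] E finite_V V_nonempty
    by (simp add: \<Omega>_def)
qed

end

section \<open>Many separated points on a random graph\<close>

text \<open>A lower bound on the covering number of the graph is expressed through finite sets and
  strict inequalities, which makes the condition open in \<open>f\<close> and its complement closed,
  hence Borel.\<close>

definition separated_graphs :: "'a::metric_space set \<Rightarrow> real \<Rightarrow> real \<Rightarrow> ('a \<Rightarrow>\<^sub>C 'b::metric_space) set" where
  "separated_graphs A \<delta> s = {f. \<exists>S\<subseteq>A. finite S \<and> s \<le> real (card S) \<and>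
     pairwise (\<lambda>x y. dist (x, apply_bcontfun f x) (y, apply_bcontfun f y) > 2 * \<delta>) S}"

lemma open_separated_graphs: "open (separated_graphs A \<delta> s)"
proof -
  define G :: "'a set \<Rightarrow> ('a \<Rightarrow>\<^sub>C 'b) set" where "G S = {f. pairwise (\<lambda>x y.
    dist (x, apply_bcontfun f x) (y, apply_bcontfun f y) > 2 * \<delta>) S}" for S
  have "open (G S)" if "finite S" for S
  proof -
    have "G S = (\<Inter>z\<in>{z \<in> S \<times> S. fst z \<noteq> snd z}.
      {f. 2 * \<delta> < dist (fst z, apply_bcontfun f (fst z)) (snd z, apply_bcontfun f (snd z))})"
      unfolding G_def pairwise_def by auto
    moreover have "finite {z \<in> S \<times> S. fst z \<noteq> snd z}" using that by simp
    ultimately show ?thesis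
      by (simp only:) (intro open_INT ballI open_Collect_less continuous_intros continuous_on_eval_bcontfun)
  qed
  then have "open (\<Union>S\<in>{S. S \<subseteq> A \<and> finite S \<and> s \<le> real (card S)}. G S)" by blast
  moreover have "separated_graphs A \<delta> s = (\<Union>S\<in>{S. S \<subseteq> A \<and> finite S \<and> s \<le> real (card S)}. G S)"
    unfolding separated_graphs_def G_def by auto
  ultimately show ?thesis by simp
qed

text \<open>At most \<open>card (P n) * card (V n) / m\<close> ordered pairs are close in the base,
  and each of them has close values with probability at most \<open>1 / card (V n)\<close>. The
  expected number of bad pairs is thus at most \<open>card (P n) / m\<close>, and by Markov's
  inequality it reaches half of \<open>card (P n)\<close> with probability at most
  \<open>2 / m\<close>. Otherwise at least half of the points survive.\<close>

lemma (in random_tents) prob_not_separated_le: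
  assumes m: "m > 0" and \<delta>: "\<delta> > 0" and P: "P n \<noteq> {}" "P n \<subseteq> A"
    and few: "\<And>p. p \<in> P n \<Longrightarrow> m * card {q \<in> P n. dist p q \<le> 2 * \<delta>} \<le> card (V n)"
    and s: "2 * s \<le> real (card (P n))"
    and sep: "pairwise (\<lambda>u v. dist u v > 4 * \<delta>) (V n)"
  shows "prob {\<omega> \<in> space \<Omega>. \<Psi> \<omega> + g \<notin> separated_graphs A \<delta> s} \<le> 2 / real m"
proof -
  let ?V = "real (card (V n))" and ?P = "real (card (P n))"
  \<comment> \<open>Graph distance dominates base distance, so only pairs that are close in the base
    can fail to be separated on the graph.\<close>
  define D where "D = (SIGMA p:P n. {q \<in> P n. dist p q \<le> 2 * \<delta>} - {p})"
  define E where "E z = {\<omega> \<in> space \<Omega>. dist (apply_bcontfun (\<Psi> \<omega> + g) (fst z)) (apply_bcontfun (\<Psi> \<omega> + g) (snd z)) \<le> 2 * \<delta>}" for z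
  define X where "X \<omega> = (\<Sum>z\<in>D. indicator (E z) \<omega> :: real)" for \<omega>
  have V0: "?V > 0" and P0: "?P > 0"
    using finite_V[of n] V_nonempty[of n] finite_P[of n] P(1) by (simp_all add: card_gt_0_iff)
  have finD: "finite D" unfolding D_def using finite_P by (intro finite_SigmaI) auto
  have E: "E z \<in> sets \<Omega>" "prob (E z) \<le> 1 / ?V" if "z \<in> D" for z
  proof -
    have "fst z \<in> P n" "snd z \<in> P n" "fst z \<noteq> snd z" using that unfolding D_def by auto
    then show "E z \<in> sets \<Omega>" "prob (E z) \<le> 1 / ?V"
      unfolding E_def by (rule prob_close_pair_le; use sep in simp)+
  qed
  have "real m * real (card D) = (\<Sum>p\<in>P n. real (m * card ({q \<in> P n. dist p q \<le> 2 * \<delta>} - {p})))"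
    unfolding D_def using finite_P[of n] by (subst card_SigmaI) (auto simp: sum_distrib_left)
  also have "\<dots> \<le> (\<Sum>p\<in>P n. ?V)"
  proof (intro sum_mono of_nat_mono)
    fix p assume "p \<in> P n"
    have "card ({q \<in> P n. dist p q \<le> 2 * \<delta>} - {p}) \<le> card {q \<in> P n. dist p q \<le> 2 * \<delta>}"
      using finite_P[of n] by (intro card_mono) auto
    then have "m * card ({q \<in> P n. dist p q \<le> 2 * \<delta>} - {p}) \<le> m * card {q \<in> P n. dist p q \<le> 2 * \<delta>}"
      by (rule mult_le_mono2)
    also have "\<dots> \<le> card (V n)" using few[OF \<open>p \<in> P n\<close>] .
    finally show "m * card ({q \<in> P n. dist p q \<le> 2 * \<delta>} - {p}) \<le> card (V n)" .
  qed
  finally have cardD: "real m * real (card D) \<le> ?P * ?V" by simp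
  have E_int: "integrable \<Omega> (indicator (E z) :: _ \<Rightarrow> real)" if "z \<in> D" for z
    using E(1)[OF that] by (simp add: integrable_indicator_iff sets.Int_space_eq2 emeasure_eq_measure)
  then have int: "integrable \<Omega> X"
    unfolding X_def by (intro Bochner_Integration.integrable_sum) auto
  have "(\<integral>\<omega>. X \<omega> \<partial>\<Omega>) = (\<Sum>z\<in>D. prob (E z))"
    unfolding X_def using E(1) E_int
    by (subst Bochner_Integration.integral_sum) (auto simp: sets.Int_space_eq2 intro!: sum.cong)
  also have "\<dots> \<le> (\<Sum>z\<in>D. 1 / ?V)" by (intro sum_mono E(2))
  also have "\<dots> = real (card D) / ?V" by simp
  also have "\<dots> \<le> ?P / real m"
    using cardD V0 m by (simp add: field_simps)
  finally have EX: "(\<integral>\<omega>. X \<omega> \<partial>\<Omega>) \<le> ?P / real m" .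
  have "{\<omega> \<in> space \<Omega>. \<Psi> \<omega> + g \<notin> separated_graphs A \<delta> s} \<subseteq> {\<omega> \<in> space \<Omega>. X \<omega> \<ge> ?P / 2}"
  proof (rule subsetI, rule ccontr)
    fix \<omega> assume \<omega>: "\<omega> \<in> {\<omega> \<in> space \<Omega>. \<Psi> \<omega> + g \<notin> separated_graphs A \<delta> s}"
      and "\<omega> \<notin> {\<omega> \<in> space \<Omega>. X \<omega> \<ge> ?P / 2}"
    then have X: "X \<omega> < ?P / 2" by auto
    define Z where "Z = {z \<in> D. \<omega> \<in> E z}"
    have "X \<omega> = real (card Z)"
      unfolding X_def Z_def using finD by (simp add: indicator_def sum.If_cases Int_def)
    then have Z: "real (card Z) < ?P / 2" using X by simp
    \<comment> \<open>Removing the first point of every bad pair destroys all bad pairs and costs at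
      most \<open>card Z\<close> points.\<close>
    define S where "S = P n - fst ` Z"
    have finZ: "finite Z" unfolding Z_def using finD by simp
    have sub: "fst ` Z \<subseteq> P n" unfolding Z_def D_def by auto
    have "card S = card (P n) - card (fst ` Z)"
      unfolding S_def using sub finZ by (intro card_Diff_subset) auto
    moreover have "card (fst ` Z) \<le> card (P n)" using sub finite_P by (intro card_mono)
    moreover have "card (fst ` Z) \<le> card Z" using finZ by (rule card_image_le)
    ultimately have "s \<le> real (card S)" using Z s by (simp add: of_nat_diff)
    moreover have "S \<subseteq> A" "finite S" using P(2) finite_P[of n] by (auto simp: S_def)
    moreover have "pairwise (\<lambda>x y. dist (x, apply_bcontfun (\<Psi> \<omega> + g) x) (y, apply_bcontfun (\<Psi> \<omega> + g) y) > 2 * \<delta>) S"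
    proof (rule pairwiseI, rule ccontr)
      fix x y assume xy: "x \<in> S" "y \<in> S" "x \<noteq> y"
        and "\<not> dist (x, apply_bcontfun (\<Psi> \<omega> + g) x) (y, apply_bcontfun (\<Psi> \<omega> + g) y) > 2 * \<delta>"
      then have "dist (x, apply_bcontfun (\<Psi> \<omega> + g) x) (y, apply_bcontfun (\<Psi> \<omega> + g) y) \<le> 2 * \<delta>" by simp
      then have "dist x y \<le> 2 * \<delta>" "dist (apply_bcontfun (\<Psi> \<omega> + g) x) (apply_bcontfun (\<Psi> \<omega> + g) y) \<le> 2 * \<delta>"
        using dist_fst_le[of "(x, apply_bcontfun (\<Psi> \<omega> + g) x)" "(y, apply_bcontfun (\<Psi> \<omega> + g) y)"]
          dist_snd_le[of "(x, apply_bcontfun (\<Psi> \<omega> + g) x)" "(y, apply_bcontfun (\<Psi> \<omega> + g) y)"] by simp_all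
      then have "(x, y) \<in> Z"
        using xy \<omega> by (auto simp: Z_def D_def E_def S_def)
      then have "x \<in> fst ` Z" by force
      then show False using xy(1) by (simp add: S_def)
    qed
    ultimately have "\<Psi> \<omega> + g \<in> separated_graphs A \<delta> s"
      unfolding separated_graphs_def by blast
    then show False using \<omega> by simp
  qed
  then have "prob {\<omega> \<in> space \<Omega>. \<Psi> \<omega> + g \<notin> separated_graphs A \<delta> s} \<le> prob {\<omega> \<in> space \<Omega>. X \<omega> \<ge> ?P / 2}"
    using borel_measurable_integrable[OF int] by (intro finite_measure_mono) measurable
  also have "\<dots> \<le> (\<integral>\<omega>. X \<omega> \<partial>\<Omega>) / (?P / 2)"
    by (rule integral_Markov_inequality_measure[OF int, of "{}"])
      (use P0 in \<open>auto simp: X_def intro!: sum_nonneg\<close>)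
  also have "\<dots> \<le> (?P / real m) / (?P / 2)"
    using EX P0 by (intro divide_right_mono) auto
  also have "\<dots> = 2 / real m" using P0 by simp
  finally show ?thesis .
qed

section \<open>Prevalence\<close>

lemma prevalent_mono: "prevalent A \<Longrightarrow> A \<subseteq> B \<Longrightarrow> prevalent B"
  unfolding prevalent_def shy_def by (meson Compl_anti_mono order_trans)

text \<open>The law of \<open>\<Psi>\<close> is the measure witnessing shyness; under it, the
  translate of \<open>B\<close> by \<open>x\<close> has the probability of the event
  \<open>\<Psi> \<omega> + - x \<in> B\<close>.\<close>

lemma prevalent_random_translateI:
  fixes \<Psi> :: "'w \<Rightarrow> 'g::topological_ab_group_add"
  assumes M: "prob_space M" and \<Psi>: "\<Psi> \<in> borel_measurable M"
    and B: "B \<in> sets borel" "- A \<subseteq> B"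
    and null: "\<And>g. emeasure M {\<omega> \<in> space M. \<Psi> \<omega> + g \<in> B} = 0"
  shows "prevalent A"
  unfolding prevalent_def shy_def
proof (intro exI conjI allI)
  show "prob_space (distr M borel \<Psi>)" using M \<Psi> by (rule prob_space.prob_space_distr)
  fix x :: 'g
  have "continuous_on UNIV (\<lambda>f :: 'g. f + - x)" by (intro continuous_intros)
  then have "(\<lambda>f. f + - x) \<in> borel_measurable borel" by (rule borel_measurable_continuous_onI)
  then have "(\<lambda>f. f + - x) -` B \<inter> space borel \<in> sets borel" using B(1) by (rule measurable_sets)
  moreover have eq: "(\<lambda>b. b + x) ` B = (\<lambda>f. f + - x) -` B"
  proof
    show "(\<lambda>f. f + - x) -` B \<subseteq> (\<lambda>b. b + x) ` B"
      by (auto intro!: image_eqI[of _ "\<lambda>b. b + x" "f + - x" for f])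
  qed (auto simp: add.assoc)
  ultimately have "(\<lambda>b. b + x) ` B \<in> sets borel" by simp
  then have "emeasure (distr M borel \<Psi>) ((\<lambda>b. b + x) ` B) = emeasure M (\<Psi> -` ((\<lambda>b. b + x) ` B) \<inter> space M)"
    by (rule emeasure_distr[OF \<Psi>])
  also have "\<Psi> -` ((\<lambda>b. b + x) ` B) \<inter> space M = {\<omega> \<in> space M. \<Psi> \<omega> + - x \<in> B}"
    unfolding eq by auto
  finally show "emeasure (distr M borel \<Psi>) ((\<lambda>b. b + x) ` B) = 0" using null[of "- x"] by simp
qed (use B in simp_all)

lemma finite_uniformly_separated:
  assumes "finite (P :: 'a::metric_space set)"
  obtains \<rho> where "\<rho> > 0" "\<And>p q. p \<in> P \<Longrightarrow> q \<in> P \<Longrightarrow> p \<noteq> q \<Longrightarrow> 2 * \<rho> \<le> dist p q"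
proof -
  \<comment> \<open>Inserting 1 keeps the minimum defined when \<open>P\<close> has at most one
    point.\<close>
  define D where "D = insert 1 ((\<lambda>(p, q). dist p q) ` {(p, q) \<in> P \<times> P. p \<noteq> q})"
  have "finite {(p, q) \<in> P \<times> P. p \<noteq> q}"
    by (rule finite_subset[of _ "P \<times> P"]) (use assms in auto)
  then have D: "finite D" "D \<noteq> {}" unfolding D_def by auto
  have "Min D > 0" using D by (auto simp: D_def)
  moreover have "2 * (Min D / 2) \<le> dist p q" if "p \<in> P" "q \<in> P" "p \<noteq> q" for p q
  proof -
    have "dist p q \<in> D" using that unfolding D_def by force
    then show ?thesis using D(1) by simp
  qed
  ultimately show thesis using that[of "Min D / 2"] by simp
qed

lemma covering_number_graph_over_ge:
  assumes "f \<in> separated_graphs A \<delta> s" "\<delta> > 0" "totally_bounded (graph_over (apply_bcontfun f) A)"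
  shows "s \<le> real (covering_number (graph_over (apply_bcontfun f) A) \<delta>)"
proof -
  obtain S where S: "S \<subseteq> A" "finite S" "s \<le> real (card S)"
    "pairwise (\<lambda>x y. dist (x, apply_bcontfun f x) (y, apply_bcontfun f y) > 2 * \<delta>) S"
    using assms(1) unfolding separated_graphs_def by blast
  have "pairwise (\<lambda>x y. dist x y > 2 * \<delta>) (graph_over (apply_bcontfun f) S)"
    using S(4) unfolding graph_over_def pairwise_image by (auto simp: pairwise_def)
  then have "card (graph_over (apply_bcontfun f) S) \<le> covering_number (graph_over (apply_bcontfun f) A) \<delta>"
    using card_separated_le_covering_number[OF assms(3,2) graph_over_mono[OF S(1)]] by blast
  moreover have "card (graph_over (apply_bcontfun f) S) = card S"
    unfolding graph_over_def by (rule card_image) (auto intro: inj_onI)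
  ultimately show ?thesis using S(3) by simp
qed

text \<open>One random function serves all \<open>A i\<close>, with each level devoted to one index.
  The bound can fail for \<open>i\<close> only if all levels devoted to \<open>i\<close> fail from
  some \<open>m\<close> on. Level \<open>n\<close> fails with probability at most
  \<open>1 / Suc n\<close>, so this event is null for fixed \<open>i\<close> and \<open>m\<close>,
  and there are countably many such pairs.\<close>

lemma prevalent_upper_box_dim_graphs:
  fixes A :: "nat \<Rightarrow> 'k::metric_space set" and t :: "nat \<Rightarrow> real"
  assumes K: "compact (UNIV :: 'k set)"
    and A: "\<And>i. A i \<noteq> {}"
    and inf: "\<And>i x r. x \<in> A i \<Longrightarrow> r > 0 \<Longrightarrow> infinite (A i \<inter> ball x r)"
    and t: "\<And>i. ereal (t i) < upper_box_dim (A i)"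
  shows "prevalent {f :: 'k \<Rightarrow>\<^sub>C (real ^ 'd).
    \<forall>i. ereal (t i + real CARD('d)) \<le> upper_box_dim (graph_over (apply_bcontfun f) (A i))}"
proof -
  let ?d = "real CARD('d)"
  \<comment> \<open>The schedule of the levels: the first component of a decoded pair takes every
    value infinitely often.\<close>
  define l where "l n = fst (prod_decode n)" for n
  have l: "\<exists>n\<ge>m. l n = i" for m i
    by (rule exI[of _ "prod_encode (i, m)"]) (simp add: l_def le_prod_encode_2)
  \<comment> \<open>The exponent falls short of \<open>t + d\<close> by \<open>1 / Suc n\<close>, a
    loss that vanishes along the levels.\<close>
  define s where "s n \<delta> = \<delta> powr (- (t (l n) + ?d - 1 / Suc n))" for n and \<delta> :: real
  \<comment> \<open>The multiplicity \<open>2 * Suc n\<close> turns the failure probability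
    \<open>2 / m\<close> into \<open>1 / Suc n\<close>; the bound on \<open>\<delta>\<close> forces
    the scales to 0.\<close>
  define R where "R n \<delta> P V \<longleftrightarrow> 0 < \<delta> \<and> \<delta> < 1 / Suc n \<and> finite P \<and> P \<subseteq> A (l n) \<and> finite V \<and>
      (\<forall>p\<in>P. (2 * Suc n) * card {q \<in> P. dist p q \<le> 2 * \<delta>} \<le> card V) \<and>
      2 * s n \<delta> \<le> real (card P) \<and>
      pairwise (\<lambda>u v. dist u v > 4 * \<delta>) V \<and> (\<forall>v\<in>V. norm v \<le> (1 / 2) ^ n)"
    for n \<delta> P and V :: "(real ^ 'd) set"
  have "\<exists>\<delta> P V. R n \<delta> P V" for n
  proof -
    have tb: "totally_bounded (A (l n))" using K by (rule totally_bounded_compact) simp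
    have pos: "1 / real (Suc n) > 0" "(1 / 2 :: real) ^ n > 0" "2 * Suc n > 0" by simp_all
    show ?thesis
      by (rule ex_configuration[where ?'d = 'd, OF tb A _ t pos(1) pos(2) pos(1) pos(3)])
        (erule (1) inf, unfold R_def s_def, blast)
  qed
  then obtain \<delta> P V where R: "\<And>n. R n (\<delta> n) (P n) (V n)" by metis
  have \<delta>: "\<And>n. 0 < \<delta> n" "\<And>n. \<delta> n < 1 / Suc n" and P: "\<And>n. finite (P n)" "\<And>n. P n \<subseteq> A (l n)"
    and V: "\<And>n. finite (V n)"
    and few: "\<And>n p. p \<in> P n \<Longrightarrow> (2 * Suc n) * card {q \<in> P n. dist p q \<le> 2 * \<delta> n} \<le> card (V n)"
    and many: "\<And>n. 2 * s n (\<delta> n) \<le> real (card (P n))"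
    and sep: "\<And>n. pairwise (\<lambda>u v. dist u v > 4 * \<delta> n) (V n)"
    and norm: "\<And>n v. v \<in> V n \<Longrightarrow> norm v \<le> (1 / 2) ^ n"
    using R unfolding R_def by blast+
  have P_nonempty: "P n \<noteq> {}" for n
  proof
    assume "P n = {}"
    then have "s n (\<delta> n) \<le> 0" using many[of n] by simp
    then show False using \<delta>(1)[of n] by (simp add: s_def)
  qed
  \<comment> \<open>Every \<open>p\<close> counts among its own neighbours, so \<open>few\<close>
    forces the grid to be non-empty.\<close>
  have V_nonempty: "V n \<noteq> {}" for n
  proof
    assume V0: "V n = {}"
    obtain p where p: "p \<in> P n" using P_nonempty by blast
    then have "card {q \<in> P n. dist p q \<le> 2 * \<delta> n} = 0" using few[OF p] V0 by simp
    then have "{q \<in> P n. dist p q \<le> 2 * \<delta> n} = {}" using P(1)[of n] by simp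
    then show False using p \<delta>(1)[of n] by auto
  qed
  have "\<exists>\<rho>>0. \<forall>p\<in>P n. \<forall>q\<in>P n. p \<noteq> q \<longrightarrow> 2 * \<rho> \<le> dist p q" for n
    using finite_uniformly_separated[OF P(1)[of n]] by metis
  then obtain \<rho> where \<rho>: "\<And>n. \<rho> n > 0"
      "\<And>n p q. p \<in> P n \<Longrightarrow> q \<in> P n \<Longrightarrow> p \<noteq> q \<Longrightarrow> 2 * \<rho> n \<le> dist p q" by metis
  interpret random_tents P V \<rho>
    using P(1) V V_nonempty norm \<rho> by unfold_locales
  define G :: "nat \<Rightarrow> ('k \<Rightarrow>\<^sub>C (real ^ 'd)) set"
    where "G n = separated_graphs (A (l n)) (\<delta> n) (s n (\<delta> n))" for n
  \<comment> \<open>The functions for which no level devoted to \<open>i\<close> succeeds from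
    \<open>m\<close> on, a closed set as an intersection of complements of open ones.\<close>
  define C where "C i m = (\<Inter>n\<in>{n. m \<le> n \<and> l n = i}. - G n)" for i m
  have closed_C: "closed (C i m)" for i m
    unfolding C_def G_def by (intro closed_INT ballI closed_Compl open_separated_graphs)
  have null: "emeasure \<Omega> {\<omega> \<in> space \<Omega>. \<Psi> \<omega> + g \<in> C i m} = 0"
    and meas: "{\<omega> \<in> space \<Omega>. \<Psi> \<omega> + g \<in> C i m} \<in> sets \<Omega>" for g i m
  proof -
    have mb: "{\<omega> \<in> space \<Omega>. \<Psi> \<omega> + g \<in> X} \<in> sets \<Omega>" if "closed X" for X
    proof -
      have "closed {f. f + g \<in> X}"
        using continuous_closed_vimage[OF that, of "\<lambda>f. f + g"] by (simp add: vimage_def continuous_intros)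
      then have "\<Psi> -` {f. f + g \<in> X} \<inter> space \<Omega> \<in> sets \<Omega>"
        by (intro measurable_sets[OF \<Psi>_measurable]) simp
      moreover have "\<Psi> -` {f. f + g \<in> X} \<inter> space \<Omega> = {\<omega> \<in> space \<Omega>. \<Psi> \<omega> + g \<in> X}" by auto
      ultimately show ?thesis by simp
    qed
    show "{\<omega> \<in> space \<Omega>. \<Psi> \<omega> + g \<in> C i m} \<in> sets \<Omega>" by (rule mb[OF closed_C])
    have "prob {\<omega> \<in> space \<Omega>. \<Psi> \<omega> + g \<in> C i m} \<le> 0 + \<epsilon>" if "\<epsilon> > 0" for \<epsilon>
    proof -
      obtain k where k: "1 / real (Suc k) < \<epsilon>" using \<open>\<epsilon> > 0\<close> nat_approx_posE by metis
      obtain n where n: "n \<ge> max m k" "l n = i" using l by blast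
      have "closed (- G n)" unfolding G_def by (intro closed_Compl open_separated_graphs)
      then have "prob {\<omega> \<in> space \<Omega>. \<Psi> \<omega> + g \<in> C i m} \<le> prob {\<omega> \<in> space \<Omega>. \<Psi> \<omega> + g \<in> - G n}"
        using n by (intro finite_measure_mono mb) (auto simp: C_def)
      also have "\<dots> \<le> 2 / real (2 * Suc n)"
        unfolding G_def Compl_iff
        using P_nonempty P(2) \<delta>(1) many sep few
        by (intro prob_not_separated_le) auto
      also have "\<dots> = 1 / real (Suc n)" by (simp add: field_simps)
      also have "\<dots> \<le> 1 / real (Suc k)" using n(1) by (intro divide_left_mono) auto
      finally show ?thesis using k by simp
    qed
    then have "prob {\<omega> \<in> space \<Omega>. \<Psi> \<omega> + g \<in> C i m} \<le> 0" by (rule field_le_epsilon)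
    then show "emeasure \<Omega> {\<omega> \<in> space \<Omega>. \<Psi> \<omega> + g \<in> C i m} = 0"
      by (simp add: emeasure_eq_measure measure_le_0_iff)
  qed
  show ?thesis
  proof (rule prevalent_random_translateI[OF prob_space_axioms \<Psi>_measurable])
    show "(\<Union>i. \<Union>m. C i m) \<in> sets borel" using closed_C by (intro sets.countable_UN) auto
    show "emeasure \<Omega> {\<omega> \<in> space \<Omega>. \<Psi> \<omega> + g \<in> (\<Union>i. \<Union>m. C i m)} = 0" for g
    proof -
      have "{\<omega> \<in> space \<Omega>. \<Psi> \<omega> + g \<in> (\<Union>i. \<Union>m. C i m)} = (\<Union>i. \<Union>m. {\<omega> \<in> space \<Omega>. \<Psi> \<omega> + g \<in> C i m})"
        by auto
      also have "\<dots> \<in> null_sets \<Omega>"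
        using null meas by (intro null_sets_UN) (auto intro: null_setsI)
      finally show ?thesis by auto
    qed
    show "- {f. \<forall>i. ereal (t i + ?d) \<le> upper_box_dim (graph_over (apply_bcontfun f) (A i))}
        \<subseteq> (\<Union>i. \<Union>m. C i m)"
    proof (rule subsetI, rule ccontr)
      fix f assume f: "f \<in> - {f. \<forall>i. ereal (t i + ?d) \<le> upper_box_dim (graph_over (apply_bcontfun f) (A i))}"
        and "f \<notin> (\<Union>i. \<Union>m. C i m)"
      then have fG: "\<exists>n\<ge>m. l n = i \<and> f \<in> G n" for m i by (auto simp: C_def)
      obtain i where "upper_box_dim (graph_over (apply_bcontfun f) (A i)) < ereal (t i + ?d)"
        using f by (auto simp: not_le)
      then obtain c where c: "upper_box_dim (graph_over (apply_bcontfun f) (A i)) < ereal c" "c < t i + ?d"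
        using ereal_dense2 by (metis ereal_less(3) less_ereal.simps(1))
      let ?X = "graph_over (apply_bcontfun f) (A i)"
      have "compact (graph_over (apply_bcontfun f) UNIV)"
        by (intro compact_graph_over K continuous_on_apply_bcontfun)
      then have tb: "totally_bounded ?X" by (rule totally_bounded_compact) (simp add: graph_over_mono)
      have "\<exists>\<^sub>F r in at_right 0. r powr (- c) \<le> real (covering_number ?X r)"
        unfolding frequently_def eventually_at_right_field
      proof
        assume "\<exists>b>0. \<forall>r>0. r < b \<longrightarrow> \<not> r powr (- c) \<le> real (covering_number ?X r)"
        then obtain b where b: "b > 0" "\<And>r. 0 < r \<Longrightarrow> r < b \<Longrightarrow> \<not> r powr (- c) \<le> real (covering_number ?X r)"
          by blast
        \<comment> \<open>Any level past the resulting \<open>k\<close> has a scale below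
          \<open>b\<close> and an exponent loss smaller than the gap between \<open>c\<close> and
          \<open>t i + d\<close>.\<close>
        have "min b (t i + ?d - c) > 0" using b(1) c(2) by simp
        then obtain k where k: "1 / real (Suc k) < min b (t i + ?d - c)" using nat_approx_posE by metis
        obtain n where n: "n \<ge> k" "l n = i" "f \<in> G n" using fG by blast
        have nk: "1 / real (Suc n) \<le> 1 / real (Suc k)" using n(1) by (intro divide_left_mono) auto
        have "1 / real (Suc n) \<le> 1" by simp
        then have \<delta>1: "\<delta> n < 1" using \<delta>(2)[of n] by linarith
        have "\<delta> n powr (- c) \<le> s n (\<delta> n)"
          unfolding s_def using \<delta>(1)[of n] \<delta>1 k nk n(2) by (intro powr_mono') auto
        also have "\<dots> \<le> real (covering_number ?X (\<delta> n))"
          using n(3) \<delta>(1) tb unfolding G_def n(2) by (rule covering_number_graph_over_ge)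
        finally show False using b(2)[of "\<delta> n"] \<delta>[of n] k nk by simp
      qed
      then have "ereal c \<le> upper_box_dim ?X" using A by (intro le_upper_box_dimI tb) simp_all
      then show False using c(1) by simp
    qed
  qed
qed

section \<open>Assembly over countably many portions\<close>

theorem theorem7p6:
  assumes "compact (UNIV :: 'k::metric_space set)"
    and "uncountable (UNIV :: 'k set)"
    and "non_exploding (UNIV :: 'k set)"
  shows "prevalent {f :: 'k \<Rightarrow>\<^sub>C (real ^ 'd).
    packing_dim (fun_graph (apply_bcontfun f)) =
      packing_dim (UNIV :: 'k set) + ereal (real CARD('d))}"
proof -
  let ?D = "packing_dim (UNIV :: 'k set)" and ?d = "real CARD('d)"
  \<comment> \<open>Countably many exponents approach the packing dimension of the space from below,
    even if it is infinite; each gets its own kernel \<open>F q\<close>.\<close>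
  define Q where "Q = {q :: rat. ereal (of_rat q) < ?D}"
  have "\<exists>F :: 'k set. closed F \<and> F \<noteq> {} \<and>
    (\<forall>U. open U \<longrightarrow> F \<inter> U \<noteq> {} \<longrightarrow> infinite (F \<inter> U) \<and> ereal (of_rat q) < upper_box_dim (F \<inter> U))"
    if "q \<in> Q" for q
  proof -
    have "ereal (of_rat q) < ?D" using that by (simp add: Q_def)
    then show ?thesis by (rule closed_kernel_with_large_portions[OF assms(1,2)]) blast
  qed
  then obtain F :: "rat \<Rightarrow> 'k set" where F: "\<And>q. q \<in> Q \<Longrightarrow> closed (F q)" "\<And>q. q \<in> Q \<Longrightarrow> F q \<noteq> {}"
    "\<And>q U. q \<in> Q \<Longrightarrow> open U \<Longrightarrow> F q \<inter> U \<noteq> {} \<Longrightarrow>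
      infinite (F q \<inter> U) \<and> ereal (of_rat q) < upper_box_dim (F q \<inter> U)"
    by metis
  obtain \<B> :: "'k set set" where \<B>: "countable \<B>" "\<And>B. B \<in> \<B> \<Longrightarrow> open B"
    "\<And>U x. open U \<Longrightarrow> x \<in> U \<Longrightarrow> \<exists>B\<in>\<B>. x \<in> B \<and> B \<subseteq> U"
    using compact_countable_basis[OF assms(1)] by blast
  \<comment> \<open>Every non-empty portion of \<open>F q\<close> contains a non-empty one cut out
    by a basis set, so this countable family of portions is enough.\<close>
  define I where "I = {(q, B) \<in> Q \<times> \<B>. F q \<inter> B \<noteq> {}}"
  have "countable (Q \<times> \<B>)" using \<B>(1) by (intro countable_SIGMA) auto
  then have "countable I" by (rule countable_subset[rotated]) (auto simp: I_def)
  \<comment> \<open>This puts \<open>- 1\<close> into \<open>Q\<close>, so that \<open>I\<close> is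
    non-empty and can be enumerated by \<open>from_nat_into\<close>.\<close>
  have "0 \<le> ?D"
    unfolding packing_dim_def
  proof (rule Inf_greatest, clarify)
    fix Y :: "nat \<Rightarrow> 'k set" assume Y: "UNIV = (\<Union>i. Y i)"
    then obtain j where "Y j \<noteq> {}" by blast
    then show "0 \<le> (SUP i. upper_box_dim (Y i))"
      using upper_box_dim_nonneg by (intro SUP_upper2[of j]) auto
  qed
  then have "ereal (of_rat (- 1)) < ?D" by (rule less_le_trans[rotated]) simp
  then have "- 1 \<in> Q" by (simp add: Q_def)
  moreover obtain x where "x \<in> F (- 1)" using F(2)[OF calculation] by blast
  moreover obtain B where "B \<in> \<B>" "x \<in> B" using \<B>(3)[of UNIV x] by auto
  ultimately have "I \<noteq> {}" unfolding I_def by blast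
  then have range_I: "range (from_nat_into I) = I" using \<open>countable I\<close> by (rule range_from_nat_into)
  define A where "A n = (case from_nat_into I n of (q, B) \<Rightarrow> F q \<inter> B)" for n
  define t where "t n = real_of_rat (fst (from_nat_into I n))" for n
  have At: "\<exists>q B. q \<in> Q \<and> B \<in> \<B> \<and> F q \<inter> B \<noteq> {} \<and> A n = F q \<inter> B \<and> t n = of_rat q" for n
  proof -
    obtain q B where qB: "from_nat_into I n = (q, B)" by (cases "from_nat_into I n") auto
    then have "(q, B) \<in> I" using from_nat_into[OF \<open>I \<noteq> {}\<close>, of n] by simp
    then have "q \<in> Q \<and> B \<in> \<B> \<and> F q \<inter> B \<noteq> {}" by (simp add: I_def)
    then show ?thesis by (intro exI[of _ q] exI[of _ B]) (simp add: A_def t_def qB)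
  qed
  have "prevalent {f :: 'k \<Rightarrow>\<^sub>C (real ^ 'd).
    \<forall>n. ereal (t n + ?d) \<le> upper_box_dim (graph_over (apply_bcontfun f) (A n))}"
  proof (rule prevalent_upper_box_dim_graphs[OF assms(1)])
    show "A n \<noteq> {}" "ereal (t n) < upper_box_dim (A n)" for n
      using At[of n] F(3) \<B>(2) by metis+
    fix n x and r :: real assume x: "x \<in> A n" "r > 0"
    obtain q B where qB: "q \<in> Q" "B \<in> \<B>" "A n = F q \<inter> B" using At by metis
    then have "F q \<inter> (B \<inter> ball x r) \<noteq> {}" "open (B \<inter> ball x r)" using x \<B>(2) by auto
    then show "infinite (A n \<inter> ball x r)"
      using F(3)[OF qB(1), of "B \<inter> ball x r"] by (simp add: qB(3) Int_assoc)
  qed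
  then show ?thesis
  proof (rule prevalent_mono, intro subsetI CollectI)
    fix f :: "'k \<Rightarrow>\<^sub>C (real ^ 'd)"
    assume f: "f \<in> {f. \<forall>n. ereal (t n + ?d) \<le> upper_box_dim (graph_over (apply_bcontfun f) (A n))}"
    let ?G = "graph_over (apply_bcontfun f)"
    have cont: "continuous_on UNIV (apply_bcontfun f)" by simp
    have tb: "totally_bounded Z" if "Z \<subseteq> ?G UNIV" for Z
      using totally_bounded_compact[OF compact_graph_over[OF assms(1) cont] that] .
    have "?D + ereal ?d \<le> packing_dim (?G UNIV)"
    proof (rule ccontr)
      assume "\<not> ?thesis"
      then have "packing_dim (?G UNIV) < ?D + ereal ?d" by simp
      then obtain c where c: "packing_dim (?G UNIV) < ereal c" "ereal c < ?D + ereal ?d"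
        using ereal_dense2 by blast
      \<comment> \<open>A rational \<open>q\<close> strictly between \<open>c - d\<close> and the
        dimension of the space gives the graph dimension at least \<open>q + d > c\<close>, a
        contradiction.\<close>
      then have "ereal (c - ?d) < ?D" by (cases ?D) auto
      then obtain q where q: "ereal (c - ?d) < ereal (of_rat q)" "ereal (of_rat q) < ?D"
        using ereal_dense3 by blast
      then have qQ: "q \<in> Q" by (simp add: Q_def)
      have "ereal (of_rat q + ?d) \<le> packing_dim (?G UNIV)"
      proof (rule le_packing_dim_graph[OF assms(1) cont F(1)[OF qQ] F(2)[OF qQ]])
        fix U assume U: "open U" "F q \<inter> U \<noteq> {}"
        then obtain x where x: "x \<in> F q" "x \<in> U" by blast
        \<comment> \<open>The basis set brings the portion into the countable family; monotonicity
          then carries the bound over to \<open>U\<close>.\<close>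
        then obtain B where B: "B \<in> \<B>" "x \<in> B" "B \<subseteq> U" using \<B>(3)[OF U(1)] by blast
        then have "(q, B) \<in> I" using x qQ by (auto simp: I_def)
        then obtain n where n: "from_nat_into I n = (q, B)" using range_I by (metis rangeE)
        have "ereal (of_rat q + ?d) \<le> upper_box_dim (?G (F q \<inter> B))"
          using f n by (auto simp: A_def t_def dest!: spec[of _ n])
        also have "\<dots> \<le> upper_box_dim (?G (F q \<inter> U))"
        proof (rule upper_box_dim_closure_mono)
          show "?G (F q \<inter> B) \<subseteq> closure (?G (F q \<inter> U))"
            using B(3) closure_subset graph_over_mono[of "F q \<inter> B" "F q \<inter> U"] by blast
        qed (auto intro!: tb graph_over_mono)
        finally show "ereal (of_rat q + ?d) \<le> upper_box_dim (?G (F q \<inter> U))" .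
      qed
      also have "\<dots> < ereal c" using c(1) .
      finally show False using q(1) by simp
    qed
    moreover have "packing_dim (?G UNIV) \<le> ?D + ereal ?d"
      using assms(1) cont by (rule packing_dim_graph_le)
    ultimately show "packing_dim (fun_graph (apply_bcontfun f)) = ?D + ereal ?d"
      unfolding fun_graph_eq by (rule antisym[rotated])
  qed
qed

end
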